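(* For a positive integer $r$, let $f_r(c)=\operatorname{disc}(H_{r+1;c})$, where $H_{r+1;c}(x)=H_{r+1}(x)+c\,H_r(x)$; it is a polynomial in $c$ of degree $2r$ with integer coefficients. Let $C_r$ be the hyperelliptic curve defined by $y^2=f_r(x)$. Then $C_r$ has no $\mathbb{Q}_2$-rational points if and only if $r\equiv2,3,4,5,6\pmod8$.
   Context: $\mathbb{Q}_2$ is the field of $2$-adic numbers. $H_n$ is the $n$-th (physicists') Hermite polynomial, $H_n(x)=(-1)^ne^{x^2}\frac{d^n}{dx^n}e^{-x^2}=\sum_{k=0}^{\lfloor n/2\rfloor}(-1)^k\frac{n!}{k!(n-2k)!}(2x)^{n-2k}$. For $f=a_0\prod_{i=1}^n(x-\alpha_i)$ of degree $n$, $\operatorname{disc}(f)=a_0^{2n-2}\prod_{1\le i<j\le n}(\alpha_i-\alpha_j)^2$. The curve $C_r$ is the complete curve: its points are the affine points $(x,y)$ with $y^2=f_r(x)$ together with two points at infinity, i.e. the curve $Y^2=Z^{2r}f_r(X/Z)$ in the weighted projective plane with coordinates $X,Y,Z$ of weights $1,r,1$. The points at infinity (those with $Z=0$) are $\mathbb{Q}_2$-rational exactly when the leading coefficient of $f_r$ is a square in $\mathbb{Q}_2$. *)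

theory Defs
  imports Complex_Main
    "HOL-Computational_Algebra.Polynomial"
    "HOL-Computational_Algebra.Fraction_Field"
begin

section \<open>The 2-adic numbers\<close>

text \<open>
  The 2-adic integers are the inverse limit of the rings of integers modulo \<open>2 ^ n\<close>: an element is a
  compatible sequence whose \<open>n\<close>-th entry is the least nonnegative residue modulo \<open>2 ^ n\<close>. The field of
  2-adic numbers is their field of fractions.
\<close>

typedef two_adic_int =
  "{x :: nat \<Rightarrow> int. \<forall>n. x n \<in> {0..<2 ^ n} \<and> x (Suc n) mod 2 ^ n = x n}"
  morphisms residue Abs_two_adic_int
  by (rule exI[of _ "\<lambda>_. 0"]) simp

setup_lifting type_definition_two_adic_int

lemma mod_Suc_pow2: "(a mod 2 ^ Suc n) mod 2 ^ n = a mod (2 ^ n :: int)"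
  by (rule mod_mod_cancel) simp

instantiation two_adic_int :: comm_ring_1
begin

lift_definition zero_two_adic_int :: two_adic_int is "\<lambda>_. 0"
  by simp

lift_definition one_two_adic_int :: two_adic_int is "\<lambda>n. 1 mod 2 ^ n"
  using mod_Suc_pow2[of 1] by simp

lift_definition plus_two_adic_int :: "two_adic_int \<Rightarrow> two_adic_int \<Rightarrow> two_adic_int"
  is "\<lambda>x y n. (x n + y n) mod 2 ^ n"
  by (auto simp: mod_Suc_pow2 simp del: power_Suc) (metis mod_add_eq)

lift_definition minus_two_adic_int :: "two_adic_int \<Rightarrow> two_adic_int \<Rightarrow> two_adic_int"
  is "\<lambda>x y n. (x n - y n) mod 2 ^ n"
  by (auto simp: mod_Suc_pow2 simp del: power_Suc) (metis mod_diff_eq)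

lift_definition uminus_two_adic_int :: "two_adic_int \<Rightarrow> two_adic_int"
  is "\<lambda>x n. (- x n) mod 2 ^ n"
  by (auto simp: mod_Suc_pow2 simp del: power_Suc) (metis mod_minus_eq)

lift_definition times_two_adic_int :: "two_adic_int \<Rightarrow> two_adic_int \<Rightarrow> two_adic_int"
  is "\<lambda>x y n. (x n * y n) mod 2 ^ n"
  by (auto simp: mod_Suc_pow2 simp del: power_Suc) (metis mod_mult_eq)

instance
proof
  fix a b c :: two_adic_int
  show "a + b + c = a + (b + c)"
    by transfer (simp add: mod_simps add.assoc)
  show "a + b = b + a"
    by transfer (simp add: add.commute)
  show "0 + a = a"
    by transfer simp
  show "- a + a = 0"
    by transfer (simp add: mod_simps)
  show "a - b = a + - b"
    by transfer (simp add: mod_simps)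
  show "a * b * c = a * (b * c)"
    by transfer (simp add: mod_simps mult.assoc)
  show "a * b = b * a"
    by transfer (simp add: mult.commute)
  show "1 * a = a"
  proof transfer
    fix x :: "nat \<Rightarrow> int"
    assume "\<forall>n. x n \<in> {0..<2 ^ n} \<and> x (Suc n) mod 2 ^ n = x n"
    then have "x n mod 2 ^ n = x n" for n
      by (auto intro: mod_pos_pos_trivial)
    then show "(\<lambda>n. (1 mod 2 ^ n * x n) mod 2 ^ n) = x"
      by (simp only: mod_mult_left_eq mult_1)
  qed
  show "(a + b) * c = a * c + b * c"
    by transfer (simp add: mod_simps distrib_right)
  show "(0 :: two_adic_int) \<noteq> 1"
    by transfer (auto simp: fun_eq_iff intro!: exI[of _ 1])
qed

end

lemma residue_mod: "m \<le> n \<Longrightarrow> residue x n mod 2 ^ m = residue x m"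
proof (induction n rule: dec_induct)
  case base
  show ?case
    by transfer (auto intro: mod_pos_pos_trivial)
next
  case (step n)
  have "(2 :: int) ^ m dvd 2 ^ n"
    using step.hyps by (simp add: le_imp_power_dvd)
  moreover have "residue x (Suc n) mod 2 ^ n = residue x n"
    by transfer simp
  ultimately show ?case
    using step.IH by (metis mod_mod_cancel)
qed

instance two_adic_int :: idom
proof
  fix a b :: two_adic_int
  assume "a \<noteq> 0" "b \<noteq> 0"
  then obtain m n where mn: "residue a m \<noteq> 0" "residue b n \<noteq> 0"
    by (metis residue_inject zero_two_adic_int.rep_eq ext)
  define u v where "u = residue a (m + n)" and "v = residue b (m + n)"
  have ndvd: "\<not> 2 ^ m dvd u" "\<not> 2 ^ n dvd v"
    using mn residue_mod[of m "m + n" a] residue_mod[of n "m + n" b]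
    by (auto simp: u_def v_def dvd_eq_mod_eq_0)
  show "a * b \<noteq> 0"
  proof
    assume "a * b = 0"
    then have "residue (a * b) (m + n) = 0"
      by (simp add: zero_two_adic_int.rep_eq)
    then have dvd: "2 ^ (m + n) dvd u * v"
      by (simp add: times_two_adic_int.rep_eq u_def v_def dvd_eq_mod_eq_0)
    have "2 ^ m dvd u \<or> 2 ^ n dvd v" if "2 ^ (m + n) dvd u * v" for m n :: nat and u v :: int
      using that
    proof (induction "m + n" arbitrary: m n u v)
      case 0
      then show ?case by simp
    next
      case (Suc k)
      show ?case
      proof (cases "m = 0 \<or> n = 0")
        case True
        then show ?thesis by auto
      next
        case False
        then obtain m' n' where [simp]: "m = Suc m'" "n = Suc n'"
          by (metis not0_implies_Suc)
        have "even (u * v)"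
          using Suc.prems by (rule dvd_trans[rotated]) simp
        then consider u' where "u = 2 * u'" | v' where "v = 2 * v'"
          by (auto elim!: evenE)
        then show ?thesis
        proof cases
          case 1
          then have "2 * 2 ^ (m' + n) dvd 2 * (u' * v)"
            using Suc.prems by (simp add: mult_ac)
          then have "2 ^ (m' + n) dvd u' * v"
            by (subst (asm) dvd_mult_cancel_left) simp
          then have "2 ^ m' dvd u' \<or> 2 ^ n dvd v"
            using Suc.hyps(1)[of m' n u' v] Suc.hyps(2) by simp
          then show ?thesis using 1 by auto
        next
          case 2
          then have "2 * 2 ^ (m + n') dvd 2 * (u * v')"
            using Suc.prems by (simp add: mult_ac)
          then have "2 ^ (m + n') dvd u * v'"
            by (subst (asm) dvd_mult_cancel_left) simp
          then have "2 ^ m dvd u \<or> 2 ^ n' dvd v'"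
            using Suc.hyps(1)[of m n' u v'] Suc.hyps(2) by simp
          then show ?thesis using 2 by auto
        qed
      qed
    qed
    with dvd ndvd show False by blast
  qed
qed

type_synonym two_adic = "two_adic_int fract"


section \<open>Discriminants and Hermite polynomials\<close>

text \<open>
  The roots \<open>\<alpha> 0, \<dots>, \<alpha> (n - 1)\<close>, listed with multiplicity, exist because the complex numbers are
  algebraically closed. They are unique up to order, and the product does not depend on the order.
\<close>

definition disc :: "complex poly \<Rightarrow> complex" where
  "disc f =
    (let n = degree f;
         \<alpha> = (SOME \<alpha> :: nat \<Rightarrow> complex. f = smult (lead_coeff f) (\<Prod>i<n. [:- \<alpha> i, 1:]))
     in lead_coeff f ^ (2 * n - 2) * (\<Prod>(i, j) \<in> {(i, j). i < j \<and> j < n}. (\<alpha> i - \<alpha> j)\<^sup>2))"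

definition hermite :: "nat \<Rightarrow> complex poly" where
  "hermite n =
    (\<Sum>k\<le>n div 2. smult ((-1) ^ k * (fact n / (fact k * fact (n - 2 * k)))) ([:0, 2:] ^ (n - 2 * k)))"

definition hermite_shift :: "nat \<Rightarrow> complex \<Rightarrow> complex poly" where
  "hermite_shift r c = hermite (r + 1) + smult c (hermite r)"

text \<open>
  An integer polynomial is determined by its values at the complex numbers, so there is at most one
  such polynomial.
\<close>

definition hermite_disc_poly :: "nat \<Rightarrow> int poly" where
  "hermite_disc_poly r =
    (THE F. \<forall>c. poly (map_poly of_int F) c = disc (hermite_shift r c))"


section \<open>Rational points of hyperelliptic curves\<close>

text \<open>
  The rational points, over the field \<open>'a\<close>, of the weighted projective plane with coordinates
  \<open>X, Y, Z\<close> of weights \<open>1, r, 1\<close>. A point outside \<open>X = Z = 0\<close> that is rational over \<open>'a\<close> has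
  coordinates in \<open>'a\<close>: scale so that \<open>X = 1\<close> or \<open>Z = 1\<close>. The curves below do not meet \<open>X = Z = 0\<close>.
\<close>

definition weighted_rel :: "nat \<Rightarrow> (('a::field \<times> 'a \<times> 'a) \<times> ('a \<times> 'a \<times> 'a)) set" where
  "weighted_rel r =
    {((X, Y, Z), (X', Y', Z')). \<exists>t. t \<noteq> 0 \<and> X' = t * X \<and> Y' = t ^ r * Y \<and> Z' = t * Z}"

definition weighted_plane :: "nat \<Rightarrow> ('a::field \<times> 'a \<times> 'a) set set" where
  "weighted_plane r = (UNIV - {(0, 0, 0)}) // weighted_rel r"

text \<open>
  The complete curve \<open>Y\<^sup>2 = Z ^ (2 * r) * F (X / Z)\<close>, where \<open>F\<close> has degree at most \<open>2 * r\<close>. The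
  right-hand side is written as a form of degree \<open>2 * r\<close>, so that it makes sense at \<open>Z = 0\<close>.
\<close>

definition hyperelliptic_points :: "nat \<Rightarrow> 'a::field poly \<Rightarrow> ('a \<times> 'a \<times> 'a) set set" where
  "hyperelliptic_points r F =
    {P \<in> weighted_plane r. \<forall>(X, Y, Z) \<in> P.
       Y\<^sup>2 = (\<Sum>i\<le>2 * r. coeff F i * X ^ i * Z ^ (2 * r - i))}"

end

theory Submission
  imports Defs "HOL-Computational_Algebra.Polynomial_Factorial" "HOL-Computational_Algebra.Fundamental_Theorem_Algebra"
begin

text \<open>
  Write \<open>n = r + 1\<close> and \<open>F = H n + c * H r\<close>. The recursion and the derivative of the Hermite
  polynomials give \<open>F' = (2 * c * x + c\<^sup>2 + 2 * n) * H r\<close> at every root \<open>x\<close> of \<open>F\<close>, so the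
  discriminant of \<open>F\<close> is, up to a power of two and a sign, the product over the roots of these two factors.
  The product of the values of \<open>H r\<close> does not depend on \<open>c\<close>: exchanging the roles of the two
  polynomials turns it into the product of \<open>H n\<close> over the roots of \<open>H r\<close>, where
  \<open>H n = - 2 * r * H (r - 1)\<close>, and one descends (\<open>prod_hermite_at_roots\<close>). The product of the linear
  factor is a value of \<open>F\<close> cleared of denominators (\<open>prod_linear_at_roots\<close>). Hence
  \<open>f c = D * (h n - c\<^sup>2 * h r)\<close>, where \<open>D\<close> is an explicit integer and \<open>h 0, h 1, \<dots>\<close> is the
  sequence with \<open>h 0 = 1\<close>, \<open>h 1 = p\<close>, \<open>h (k + 2) = p * h (k + 1) - 2 * (k + 1) * q * h k\<close> for
  \<open>p = c\<^sup>2 + 2 * n\<close> and \<open>q = c\<^sup>2\<close> (\<open>disc_hermite_shift\<close>). This is a polynomial in \<open>c\<close> of degree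
  \<open>2 * r\<close> with leading coefficient \<open>2 * D\<close>.

  A 2-adic integer congruent to 1 modulo 8 is a square. Conversely, if \<open>u\<close> is not divisible by 4 and not
  congruent to 1 modulo 8, then \<open>u * v\<^sup>2\<close> is a square only for \<open>v = 0\<close>. So everything is decided by
  square classes modulo 8. The class of \<open>D\<close> depends only on \<open>r\<close> modulo 8: for the remainders
  \<open>0, \<dots>, 7\<close> it is \<open>2, 2, 1, 3, 6, 14, 7, 1\<close> (\<open>disc_const_class\<close>). Thus \<open>2 * D\<close> is a square, and the
  points at infinity are rational, exactly for the remainders 0 and 1; for the remainder 7 both \<open>D\<close> and
  \<open>f 0 = D * (2 * n) ^ n\<close> are squares, which gives a point with \<open>x = 0\<close>.

  For the remainders 2 to 6 no value \<open>f x\<close> is a square. The sequence \<open>h\<close> is weighted homogeneous: replacing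
  \<open>p, q\<close> by \<open>l * p, l\<^sup>2 * q\<close> multiplies \<open>h k\<close> by \<open>l ^ k\<close>. This is used to divide out the common
  power of two of \<open>x\<^sup>2 + 2 * n\<close> and \<open>x\<^sup>2\<close>. Either \<open>p\<close> becomes odd, and then \<open>h\<close> modulo 4 has a closed
  form (\<open>hermite_seq_residue4\<close>); or \<open>p = 2 * t\<close> with \<open>q\<close> an odd square, and then \<open>h (2 * j)\<close> and
  \<open>h (2 * j + 1)\<close> carry explicit powers of two with cofactors that are periodic modulo 4 or 8
  (\<open>hermite_seq_double\<close>, \<open>even_odd_part_residue8\<close>, \<open>even_part_residue4\<close>). In each case \<open>f x\<close> has odd
  valuation or a unit part that is not 1 modulo 8. The delicate remainders are 3 and 5: there \<open>n\<close> is
  even, and for even \<open>x\<close> the valuation of \<open>x\<close> decides which of the two shapes occurs.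
\<close>

section \<open>The two-parameter Hermite sequence\<close>

text \<open>
  The values of the Hermite polynomials, made homogeneous: \<open>p\<close> stands for \<open>2 * x\<close> with weight 1 and \<open>q\<close>
  for \<open>1\<close> with weight 2. Over an arbitrary ring the same sequence then serves for Hermite
  polynomials, for the discriminant as a polynomial in \<open>c\<close>, and for its 2-adic values.
\<close>

fun hermite_seq :: "'a::comm_ring_1 \<Rightarrow> 'a \<Rightarrow> nat \<Rightarrow> 'a" where
  "hermite_seq p q 0 = 1"
| "hermite_seq p q (Suc 0) = p"
| "hermite_seq p q (Suc (Suc k)) = p * hermite_seq p q (Suc k) - 2 * of_nat (Suc k) * q * hermite_seq p q k"

text \<open>
  For \<open>k = 0\<close> the factor \<open>of_nat k\<close> cancels the meaningless predecessor \<open>k - 1\<close>.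
\<close>

lemma hermite_seq_Suc: "hermite_seq p q (Suc k) = p * hermite_seq p q k - 2 * of_nat k * q * hermite_seq p q (k - 1)"
  by (cases k) simp_all

lemma hermite_seq_scale: "hermite_seq (l * p) (l ^ 2 * q) k = l ^ k * hermite_seq p q k"
proof (induction p q k rule: hermite_seq.induct)
  case (3 p q k)
  show ?case
    by (simp only: hermite_seq.simps 3) (simp add: algebra_simps power2_eq_square)
qed simp_all

lemma of_nat_times_poly: "of_nat m * p = smult (of_nat m) p"
  by (simp add: of_nat_poly)

text \<open>
  In the explicit sum, the term with index \<open>k + 1\<close> of \<open>H (n + 2)\<close> is \<open>2 * x\<close> times the term with index
  \<open>k + 1\<close> of \<open>H (n + 1)\<close> minus \<open>2 * (n + 1)\<close> times the term with index \<open>k\<close> of \<open>H n\<close>. Extending the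
  terms by zero beyond \<open>2 * k = n\<close> lets all three sums run over one index range.
\<close>

lemma hermite_eq_seq: "hermite n = hermite_seq [:0, 2:] 1 n"
proof -
  define T :: "nat \<Rightarrow> nat \<Rightarrow> complex poly" where
    "T n k = (if 2 * k \<le> n then smult ((-1) ^ k * (fact n / (fact k * fact (n - 2 * k)))) ([:0, 2:] ^ (n - 2 * k)) else 0)" for n k
  have sumT: "hermite n = (\<Sum>k\<le>N. T n k)" if "n div 2 \<le> N" for n N
  proof -
    have "hermite n = (\<Sum>k\<le>n div 2. T n k)"
      unfolding hermite_def T_def by (intro sum.cong) auto
    also have "\<dots> = (\<Sum>k\<le>N. T n k)"
      using that by (intro sum.mono_neutral_left) (auto simp: T_def)
    finally show ?thesis .
  qed
  have T0: "T (Suc (Suc n)) 0 = [:0, 2:] * T (Suc n) 0" for n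
    by (simp add: T_def del: fact_Suc)
  have TS: "T (Suc (Suc n)) (Suc k) = [:0, 2:] * T (Suc n) (Suc k) - of_nat (2 * Suc n) * T n k" for n k
  proof -
    consider "n < 2 * k" | "n = 2 * k" | d where "n = 2 * k + Suc d"
      by (metis Suc_diff_Suc add_diff_inverse_nat linorder_cases not_less_iff_gr_or_eq)
    then show ?thesis
    proof cases
      case 1
      then show ?thesis by (simp add: T_def)
    next
      case 2
      then have n: "of_nat (Suc (Suc n)) = (2 * of_nat (Suc k) :: complex)" by simp
      have "fact (Suc (Suc n)) / fact (Suc k) = (of_nat (2 * Suc n) * (fact n / fact k) :: complex)"
        unfolding fact_Suc[of "Suc n"] fact_Suc[of k] n by (simp add: divide_simps del: of_nat_Suc) simp
      with 2 show ?thesis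
        by (simp add: T_def of_nat_poly del: fact_Suc)
    next
      case 3
      have e: "n - 2 * k = Suc d" "Suc (Suc n) - 2 * Suc k = Suc d" "Suc n - 2 * Suc k = d" using 3 by auto
      have f: "fact (Suc (Suc n)) / (fact (Suc k) * fact (Suc d)) =
        (fact (Suc n) / (fact (Suc k) * fact d) + of_nat (2 * Suc n) * (fact n / (fact k * fact (Suc d))) :: complex)"
      proof -
        have nz: "of_nat (Suc k) \<noteq> (0::complex)" "of_nat (Suc d) \<noteq> (0::complex)" by (simp_all del: of_nat_Suc)
        have n: "of_nat (Suc (Suc n)) = 2 * of_nat (Suc k) + (of_nat (Suc d) :: complex)"
          by (simp add: 3)
        have "fact (Suc (Suc n)) / (fact (Suc k) * fact (Suc d)) =
          of_nat (Suc (Suc n)) * (of_nat (Suc n) * fact n) / (of_nat (Suc k) * fact k * (of_nat (Suc d) * fact d) :: complex)"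
          by simp
        also have "\<dots> = of_nat (Suc n) * fact n / (of_nat (Suc k) * fact k * fact d) + of_nat (2 * Suc n) * (fact n / (fact k * (of_nat (Suc d) * fact d)))"
          unfolding n using nz by (simp add: divide_simps del: of_nat_Suc) (simp add: algebra_simps)
        finally show ?thesis by simp
      qed
      have "T (Suc (Suc n)) (Suc k) = smult ((-1) ^ Suc k * (fact (Suc (Suc n)) / (fact (Suc k) * fact (Suc d)))) ([:0, 2:] ^ Suc d)"
        using 3 e by (simp add: T_def del: fact_Suc power_Suc)
      also have "\<dots> = [:0, 2:] * smult ((-1) ^ Suc k * (fact (Suc n) / (fact (Suc k) * fact d))) ([:0, 2:] ^ d)
         - of_nat (2 * Suc n) * smult ((-1) ^ k * (fact n / (fact k * fact (Suc d)))) ([:0, 2:] ^ Suc d)"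
        unfolding f of_nat_times_poly by (simp add: algebra_simps smult_add_left smult_diff_left del: fact_Suc of_nat_Suc mult_pCons_left mult_pCons_right)
      also have "\<dots> = [:0, 2:] * T (Suc n) (Suc k) - of_nat (2 * Suc n) * T n k"
        using 3 e by (simp add: T_def del: fact_Suc power_Suc of_nat_Suc mult_pCons_left mult_pCons_right)
      finally show ?thesis .
    qed
  qed
  have rec: "hermite (Suc (Suc n)) = [:0, 2:] * hermite (Suc n) - of_nat (2 * Suc n) * hermite n" for n
  proof -
    have "hermite (Suc (Suc n)) = T (Suc (Suc n)) 0 + (\<Sum>k\<le>n. T (Suc (Suc n)) (Suc k))"
      unfolding sum.atMost_Suc_shift[symmetric] by (rule sumT) simp
    also have "\<dots> = [:0, 2:] * (T (Suc n) 0 + (\<Sum>k\<le>n. T (Suc n) (Suc k))) - of_nat (2 * Suc n) * (\<Sum>k\<le>n. T n k)"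
      unfolding T0 TS by (simp only: sum_subtractf sum_distrib_left distrib_left add_diff_eq)
    also have "T (Suc n) 0 + (\<Sum>k\<le>n. T (Suc n) (Suc k)) = hermite (Suc n)"
      unfolding sum.atMost_Suc_shift[symmetric] by (rule sumT[symmetric]) simp
    also have "(\<Sum>k\<le>n. T n k) = hermite n"
      using sumT[of n n] by simp
    finally show ?thesis .
  qed
  show ?thesis
  proof (induction "[:0, 2:] :: complex poly" "1 :: complex poly" n rule: hermite_seq.induct)
    case 3
    then show ?case by (simp only: rec hermite_seq.simps of_nat_mult of_nat_numeral mult_1_right)
  qed (simp_all add: hermite_def)
qed

lemma hermite_Suc: "hermite (Suc n) = [:0, 2:] * hermite n - of_nat (2 * n) * hermite (n - 1)"
  unfolding hermite_eq_seq hermite_seq_Suc by simp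

lemma poly_hermite: "poly (hermite n) x = hermite_seq (2 * x) 1 n"
  unfolding hermite_eq_seq
proof (induction "[:0, 2:] :: complex poly" "1 :: complex poly" n rule: hermite_seq.induct)
  case (3 k)
  then show ?case by (simp add: of_nat_poly algebra_simps)
qed simp_all

lemma degree_hermite: "degree (hermite n) = n \<and> lead_coeff (hermite n) = 2 ^ n"
proof (induction n rule: less_induct)
  case (less n)
  have "degree (hermite n) \<le> n \<and> coeff (hermite n) n = 2 ^ n"
  proof (cases n)
    case 0
    then show ?thesis by (simp add: hermite_eq_seq)
  next
    case (Suc m)
    have d: "degree (hermite m) = m" "coeff (hermite m) m = 2 ^ m"
      using less.IH[of m] Suc by auto
    have d': "degree (hermite (m - 1)) \<le> m"
      using less.IH[of "m - 1"] Suc by auto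
    have "degree (of_nat (2 * m) * hermite (m - 1)) \<le> m"
      using d' by (simp add: of_nat_poly del: of_nat_mult)
    moreover have "degree ([:0, 2:] * hermite m) \<le> Suc m"
      using degree_mult_le[of "[:0, 2:]" "hermite m"] d by simp
    ultimately show ?thesis
      unfolding Suc hermite_Suc
      by (auto simp: d coeff_eq_0 intro: degree_diff_le)
  qed
  moreover from this have "n \<le> degree (hermite n)"
    by (intro le_degree) simp
  ultimately show ?case by auto
qed

lemma pderiv_hermite: "pderiv (hermite n) = of_nat (2 * n) * hermite (n - 1)"
proof (induction n rule: less_induct)
  case (less n)
  show ?case
  proof (cases n)
    case 0
    then show ?thesis by (simp add: hermite_eq_seq)
  next
    case (Suc m)
    show ?thesis
    proof (cases m)
      case 0
      then show ?thesis using Suc by (simp add: hermite_eq_seq pderiv_pCons of_nat_poly)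
    next
      case m: (Suc l)
      have "pderiv (hermite n) = pderiv ([:0, 2:] * hermite m - of_nat (2 * m) * hermite l)"
        unfolding Suc hermite_Suc by (simp add: m)
      also have "\<dots> = 2 * hermite m + [:0, 2:] * pderiv (hermite m) - of_nat (2 * m) * pderiv (hermite l)"
        by (simp add: pderiv_diff pderiv_mult pderiv_pCons of_nat_poly pderiv_smult numeral_poly del: of_nat_mult mult_pCons_left mult_pCons_right)
      also have "\<dots> = 2 * hermite m + of_nat (2 * m) * ([:0, 2:] * hermite l - of_nat (2 * l) * hermite (l - 1))"
        using less.IH[of m] less.IH[of l] Suc m by (simp add: algebra_simps del: mult_pCons_left mult_pCons_right)
      also have "\<dots> = 2 * hermite m + of_nat (2 * m) * hermite m"
        unfolding m hermite_Suc[of l] ..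
      finally show ?thesis using Suc by (simp add: algebra_simps)
    qed
  qed
qed

section \<open>Roots, discriminants and resultants\<close>

definition roots_of :: "complex poly \<Rightarrow> nat \<Rightarrow> (nat \<Rightarrow> complex) \<Rightarrow> bool" where
  "roots_of f n \<alpha> \<longleftrightarrow> f = smult (lead_coeff f) (\<Prod>i<n. [:- \<alpha> i, 1:])"

lemma disc_obtain_roots:
  obtains \<alpha> where "roots_of f (degree f) \<alpha>"
    "disc f = lead_coeff f ^ (2 * degree f - 2) * (\<Prod>j<degree f. \<Prod>i<j. (\<alpha> i - \<alpha> j)\<^sup>2)"
proof -
  define n where "n = degree f"
  define \<alpha> where "\<alpha> = (SOME \<alpha> :: nat \<Rightarrow> complex. f = smult (lead_coeff f) (\<Prod>i<n. [:- \<alpha> i, 1:]))"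
  obtain \<beta> where "smult (lead_coeff f) (\<Prod>i<n. [:- \<beta> i, 1:]) = f"
    unfolding n_def by (rule complex_poly_decompose'[of f])
  then have "roots_of f n \<alpha>"
    unfolding roots_of_def \<alpha>_def
    by (intro someI[where x = \<beta> and P = "\<lambda>\<alpha>. f = smult (lead_coeff f) (\<Prod>i<n. [:- \<alpha> i, 1:])"]) (rule sym)
  moreover have "(\<Prod>(i, j) \<in> {(i, j). i < j \<and> j < n}. (\<alpha> i - \<alpha> j)\<^sup>2) = (\<Prod>j<n. \<Prod>i<j. (\<alpha> i - \<alpha> j)\<^sup>2)"
    by (subst prod.Sigma, simp_all, rule prod.reindex_bij_witness[of _ "\<lambda>(j, i). (i, j)" "\<lambda>(i, j). (j, i)"]) auto
  moreover have "disc f = lead_coeff f ^ (2 * n - 2) * (\<Prod>(i, j) \<in> {(i, j). i < j \<and> j < n}. (\<alpha> i - \<alpha> j)\<^sup>2)"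
    unfolding disc_def Let_def \<alpha>_def n_def ..
  ultimately show ?thesis
    using that[of \<alpha>] unfolding n_def by simp
qed

lemma poly_roots_of: "roots_of f n \<alpha> \<Longrightarrow> poly f x = lead_coeff f * (\<Prod>i<n. x - \<alpha> i)"
  unfolding roots_of_def by (drule arg_cong[where f = "\<lambda>f. poly f x"]) (simp add: poly_prod)

lemma poly_root_eq_0: "roots_of f n \<alpha> \<Longrightarrow> i < n \<Longrightarrow> poly f (\<alpha> i) = 0"
  by (auto simp: poly_roots_of)

lemma poly_pderiv_root:
  assumes "roots_of f n \<alpha>" "i < n"
  shows "poly (pderiv f) (\<alpha> i) = lead_coeff f * (\<Prod>j\<in>{..<n} - {i}. \<alpha> i - \<alpha> j)"
proof -
  have "pderiv f = smult (lead_coeff f) (pderiv (\<Prod>i<n. [:- \<alpha> i, 1:]))"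
    using assms(1) unfolding roots_of_def by (metis pderiv_smult)
  moreover have "poly (pderiv (\<Prod>i<n. [:- \<alpha> i, 1:])) (\<alpha> i) = (\<Sum>k<n. \<Prod>j\<in>{..<n} - {k}. \<alpha> i - \<alpha> j)"
    by (simp add: pderiv_prod poly_sum poly_prod pderiv_pCons)
  moreover have "(\<Sum>k<n. \<Prod>j\<in>{..<n} - {k}. \<alpha> i - \<alpha> j) = (\<Sum>k\<in>{i}. \<Prod>j\<in>{..<n} - {k}. \<alpha> i - \<alpha> j)"
    using assms(2) by (intro sum.mono_neutral_right) auto
  ultimately show ?thesis by simp
qed

text \<open>
  Each unordered pair occurs twice on the left, as \<open>(\<alpha> i - \<alpha> j) * (\<alpha> j - \<alpha> i)\<close>. The sign is kept as a
  product over \<open>j\<close> because it cancels factor by factor against the sign in \<open>prod_hermite_at_roots\<close>.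
\<close>

lemma prod_differences_sign:
  fixes \<alpha> :: "nat \<Rightarrow> 'a::comm_ring_1"
  shows "(\<Prod>i<n. \<Prod>j\<in>{..<n} - {i}. \<alpha> i - \<alpha> j) = (\<Prod>j<n. (-1) ^ j) * (\<Prod>j<n. \<Prod>i<j. (\<alpha> i - \<alpha> j)\<^sup>2)"
proof (induction n)
  case (Suc n)
  have "(\<Prod>j\<in>{..<Suc n} - {i}. \<alpha> i - \<alpha> j) = (\<alpha> i - \<alpha> n) * (\<Prod>j\<in>{..<n} - {i}. \<alpha> i - \<alpha> j)" if "i < n" for i
  proof -
    have "{..<Suc n} - {i} = insert n ({..<n} - {i})" using that by auto
    then show ?thesis by simp
  qed
  then have "(\<Prod>i<n. \<Prod>j\<in>{..<Suc n} - {i}. \<alpha> i - \<alpha> j) = (\<Prod>i<n. \<alpha> i - \<alpha> n) * (\<Prod>i<n. \<Prod>j\<in>{..<n} - {i}. \<alpha> i - \<alpha> j)"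
    by (simp add: prod.distrib)
  moreover have "{..<Suc n} - {n} = {..<n}" by auto
  moreover have sq: "(\<Prod>i<n. \<alpha> i - \<alpha> n) * (\<Prod>i<n. \<alpha> n - \<alpha> i) = (-1) ^ n * (\<Prod>i<n. (\<alpha> i - \<alpha> n)\<^sup>2)"
  proof -
    have "(\<alpha> i - \<alpha> n) * (\<alpha> n - \<alpha> i) = (-1) * (\<alpha> i - \<alpha> n)\<^sup>2" for i
      by (simp add: algebra_simps power2_eq_square)
    then show ?thesis
      by (simp only: prod.distrib[symmetric]) (simp only: prod.distrib, simp)
  qed
  ultimately have "(\<Prod>i<Suc n. \<Prod>j\<in>{..<Suc n} - {i}. \<alpha> i - \<alpha> j) =
      (\<Prod>i<n. \<alpha> i - \<alpha> n) * (\<Prod>i<n. \<Prod>j\<in>{..<n} - {i}. \<alpha> i - \<alpha> j) * (\<Prod>i<n. \<alpha> n - \<alpha> i)"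
    by (simp only: prod.lessThan_Suc)
  also have "\<dots> = ((\<Prod>i<n. \<alpha> i - \<alpha> n) * (\<Prod>i<n. \<alpha> n - \<alpha> i)) * (\<Prod>i<n. \<Prod>j\<in>{..<n} - {i}. \<alpha> i - \<alpha> j)"
    by (simp only: mult_ac)
  also note sq
  finally show ?case by (simp add: Suc mult_ac)
qed simp

text \<open>
  Both sides are the resultant of \<open>f\<close> and \<open>g\<close>, evaluated through the roots of either polynomial; the sign
  \<open>(-1) ^ (n * m)\<close> of the exchange is trivial for \<open>n * m\<close> even, as happens for the consecutive
  degrees \<open>n\<close> and \<open>n - 1\<close>.
\<close>

lemma resultant_swap:
  assumes f: "roots_of f n \<alpha>" and g: "roots_of g m \<beta>" and nm: "even (n * m)"
  shows "lead_coeff f ^ m * (\<Prod>i<n. poly g (\<alpha> i)) = lead_coeff g ^ n * (\<Prod>j<m. poly f (\<beta> j))"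
proof -
  have "(\<Prod>i<n. \<Prod>j<m. \<alpha> i - \<beta> j) = (\<Prod>i<n. \<Prod>j<m. - 1 * (\<beta> j - \<alpha> i))"
    by simp
  also have "\<dots> = ((-1) ^ m) ^ n * (\<Prod>i<n. \<Prod>j<m. \<beta> j - \<alpha> i)"
    by (simp only: prod.distrib) simp
  also have "((-1) ^ m) ^ n = (1 :: complex)"
    using nm by (simp add: power_mult[symmetric] mult.commute)
  also have "(\<Prod>i<n. \<Prod>j<m. \<beta> j - \<alpha> i) = (\<Prod>j<m. \<Prod>i<n. \<beta> j - \<alpha> i)"
    by (rule prod.swap)
  finally show ?thesis
    by (simp add: poly_roots_of[OF f] poly_roots_of[OF g] prod.distrib)
qed

section \<open>The discriminant of a shifted Hermite polynomial\<close>

lemma hermite_shift_degree: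
  "degree (hermite_shift r c) = Suc r \<and> lead_coeff (hermite_shift r c) = 2 ^ Suc r"
proof -
  have "degree (smult c (hermite r)) < degree (hermite (Suc r))"
    using degree_hermite[of r] degree_hermite[of "Suc r"] by (auto intro: le_less_trans[OF degree_smult_le])
  then show ?thesis
    using degree_hermite[of "Suc r"] degree_hermite[of r] coeff_eq_0[of "hermite r" "Suc r"]
    unfolding hermite_shift_def by (auto simp: degree_add_eq_left)
qed

text \<open>
  By \<open>resultant_swap\<close> the product equals that of \<open>H (r + 1)\<close> over the roots of \<open>H r\<close>, the term with \<open>c\<close>
  vanishing there and the powers of the leading coefficients cancelling. By the recursion \<open>H (r + 1)\<close> is
  \<open>- 2 * r * H (r - 1)\<close> at these roots, so the induction continues with \<open>c = 0\<close>.
\<close>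

lemma prod_hermite_at_roots:
  "roots_of (hermite_shift r c) (Suc r) \<alpha> \<Longrightarrow> (\<Prod>i<Suc r. poly (hermite r) (\<alpha> i)) = (\<Prod>k\<le>r. (- 2 * of_nat k) ^ k)"
proof (induction r arbitrary: c \<alpha>)
  case 0
  then show ?case by (simp add: hermite_eq_seq)
next
  case (Suc r)
  have sh0: "hermite_shift r 0 = hermite (Suc r)"
    by (simp add: hermite_shift_def)
  obtain \<beta> where \<beta>: "roots_of (hermite (Suc r)) (Suc r) \<beta>"
    using disc_obtain_roots[of "hermite (Suc r)"] degree_hermite[of "Suc r"] by metis
  have "poly (hermite_shift (Suc r) c) (\<beta> j) = (- 2 * of_nat (Suc r)) * poly (hermite r) (\<beta> j)" if "j < Suc r" for j
    using poly_root_eq_0[OF \<beta> that] by (simp add: hermite_shift_def hermite_Suc[of "Suc r"] of_nat_poly algebra_simps)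
  then have "(\<Prod>j<Suc r. poly (hermite_shift (Suc r) c) (\<beta> j)) = (\<Prod>j<Suc r. (- 2 * of_nat (Suc r)) * poly (hermite r) (\<beta> j))"
    by (intro prod.cong) simp_all
  also have "\<dots> = (- 2 * of_nat (Suc r)) ^ Suc r * (\<Prod>j<Suc r. poly (hermite r) (\<beta> j))"
    by (simp only: prod.distrib prod_constant card_lessThan power_mult_distrib)
  also have "(\<Prod>j<Suc r. poly (hermite r) (\<beta> j)) = (\<Prod>k\<le>r. (- 2 * of_nat k) ^ k)"
    using Suc.IH[of 0 \<beta>] \<beta> sh0 by simp
  finally have "(\<Prod>j<Suc r. poly (hermite_shift (Suc r) c) (\<beta> j)) = (\<Prod>k\<le>Suc r. (- 2 * of_nat k) ^ k)"
    by (simp add: mult.commute)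
  moreover have "(2 ^ Suc (Suc r)) ^ Suc r * (\<Prod>i<Suc (Suc r). poly (hermite (Suc r)) (\<alpha> i)) =
      (2 ^ Suc r) ^ Suc (Suc r) * (\<Prod>j<Suc r. poly (hermite_shift (Suc r) c) (\<beta> j))"
    using resultant_swap[OF Suc.prems \<beta>]
    by (simp only: degree_hermite[THEN conjunct2] hermite_shift_degree[THEN conjunct2] even_mult_iff even_Suc simp_thms)
  moreover have "(2 ^ Suc (Suc r)) ^ Suc r = ((2 ^ Suc r) ^ Suc (Suc r) :: complex)"
    by (metis mult.commute power_mult)
  ultimately show ?case by (metis mult_left_cancel power_not_zero zero_neq_numeral)
qed

text \<open>
  With \<open>m = p - s\<close> this is \<open>h (r + 1) - s * h r\<close>, a rescaled value of a shifted Hermite polynomial. Eliminating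
  \<open>h (r + 1)\<close> cancels the term \<open>s * h r\<close>, which would hide the true degree, and leaves \<open>m\<close> as a
  parameter of weight 1 for the homogeneity below.
\<close>

definition disc_form :: "nat \<Rightarrow> 'a::comm_ring_1 \<Rightarrow> 'a \<Rightarrow> 'a \<Rightarrow> 'a" where
  "disc_form r m p q = m * hermite_seq p q r - 2 * of_nat r * q * hermite_seq p q (r - 1)"

lemma disc_form_scale: "r > 0 \<Longrightarrow> disc_form r (l * m) (l * p) (l ^ 2 * q) = l ^ Suc r * disc_form r m p q"
  unfolding disc_form_def hermite_seq_scale by (cases r) (simp_all add: algebra_simps power2_eq_square)

lemma disc_form_eq: "disc_form r (p - s) p q = hermite_seq p q (Suc r) - s * hermite_seq p q r"
  unfolding disc_form_def hermite_seq_Suc by (simp add: algebra_simps)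

text \<open>
  Here \<open>H' (r + 1) = 2 * (r + 1) * H r\<close> and \<open>H' r = 2 * r * H (r - 1) = 2 * x * H r - H (r + 1)\<close>, where
  \<open>H (r + 1)\<close> may be replaced by \<open>- c * H r\<close> at a root.
\<close>

lemma pderiv_at_root:
  assumes "roots_of (hermite_shift r c) (Suc r) \<alpha>" "i < Suc r"
  shows "poly (pderiv (hermite_shift r c)) (\<alpha> i) = (2 * c * \<alpha> i + (c\<^sup>2 + 2 * of_nat (Suc r))) * poly (hermite r) (\<alpha> i)"
proof -
  have 0: "poly (hermite (Suc r)) (\<alpha> i) = - c * poly (hermite r) (\<alpha> i)"
    using poly_root_eq_0[OF assms] by (simp add: hermite_shift_def add_eq_0_iff2)
  have 1: "2 * of_nat r * poly (hermite (r - 1)) (\<alpha> i) = 2 * \<alpha> i * poly (hermite r) (\<alpha> i) - poly (hermite (Suc r)) (\<alpha> i)"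
    unfolding hermite_Suc by (simp add: of_nat_poly)
  have "poly (pderiv (hermite_shift r c)) (\<alpha> i) = 2 * of_nat (Suc r) * poly (hermite r) (\<alpha> i) + c * (2 * of_nat r * poly (hermite (r - 1)) (\<alpha> i))"
    by (simp add: hermite_shift_def pderiv_add pderiv_smult pderiv_hermite of_nat_poly)
  then show ?thesis unfolding 1 0 by (simp add: algebra_simps power2_eq_square)
qed

text \<open>
  For \<open>c \<noteq> 0\<close> the linear factor is \<open>- 2 * c * (t - x)\<close> with \<open>t = - (c\<^sup>2 + 2 * (r + 1)) / (2 * c)\<close>, so the
  product is a multiple of the value of the shifted polynomial at \<open>t\<close>. Homogeneity with scaling factor
  \<open>- c\<close> removes the denominator. For \<open>c = 0\<close> the roots do not enter.
\<close>

lemma prod_linear_at_roots: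
  assumes "roots_of (hermite_shift r c) (Suc r) \<alpha>"
  shows "(\<Prod>i<Suc r. 2 * c * \<alpha> i + (c\<^sup>2 + 2 * of_nat (Suc r))) = disc_form r (2 * of_nat (Suc r)) (c\<^sup>2 + 2 * of_nat (Suc r)) (c\<^sup>2)"
proof (cases "c = 0")
  case True
  have "hermite_seq p 0 k = p ^ k" for p :: complex and k
    by (induction p "0 :: complex" k rule: hermite_seq.induct) simp_all
  then show ?thesis using True by (simp add: disc_form_def)
next
  case False
  define p where "p = c\<^sup>2 + 2 * of_nat (Suc r)"
  define t where "t = - (p / (2 * c))"
  have "(\<Prod>i<Suc r. 2 * c * \<alpha> i + p) = (\<Prod>i<Suc r. - (2 * c) * (t - \<alpha> i))"
    by (intro prod.cong) (use False in \<open>simp_all add: t_def field_simps\<close>)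
  also have "\<dots> = (- (2 * c)) ^ Suc r * (\<Prod>i<Suc r. t - \<alpha> i)"
    by (simp only: prod.distrib prod_constant card_lessThan power_mult_distrib)
  also have "\<dots> = (- c) ^ Suc r * poly (hermite_shift r c) t"
  proof -
    have "(- (2 * c)) ^ Suc r = (- c) ^ Suc r * 2 ^ Suc r"
      unfolding power_mult_distrib[symmetric] by (simp add: mult.commute)
    moreover have "poly (hermite_shift r c) t = 2 ^ Suc r * (\<Prod>i<Suc r. t - \<alpha> i)"
      using poly_roots_of[OF assms, of t] hermite_shift_degree[of r c] by metis
    ultimately show ?thesis by (simp only: mult.assoc)
  qed
  also have "\<dots> = (- c) ^ Suc r * hermite_seq (2 * t) 1 (Suc r) - c\<^sup>2 * ((- c) ^ r * hermite_seq (2 * t) 1 r)"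
    by (simp add: hermite_shift_def poly_hermite algebra_simps power2_eq_square)
  also have "\<dots> = hermite_seq p (c\<^sup>2) (Suc r) - c\<^sup>2 * hermite_seq p (c\<^sup>2) r"
  proof -
    have "- c * (2 * t) = p" using False by (simp add: t_def)
    then show ?thesis
      using hermite_seq_scale[of "- c" "2 * t" 1] by (simp del: hermite_seq.simps power_Suc)
  qed
  also have "\<dots> = disc_form r (2 * of_nat (Suc r)) p (c\<^sup>2)"
    using disc_form_eq[of r p "c\<^sup>2" "c\<^sup>2"] by (simp add: p_def)
  finally show ?thesis by (simp add: p_def)
qed

definition disc_const :: "nat \<Rightarrow> int" where
  "disc_const r = 2 ^ ((r + 1) * (r - 1)) * (\<Prod>k\<le>r. (2 * int k) ^ k)"

text \<open>
  Up to the sign of \<open>prod_differences_sign\<close>, the discriminant is the product of the derivative over the roots, so that it splits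
  into the two products computed above. The two signs cancel.
\<close>

theorem disc_hermite_shift:
  assumes "r > 0"
  shows "disc (hermite_shift r c) = of_int (disc_const r) * disc_form r (2 * of_nat (Suc r)) (c\<^sup>2 + 2 * of_nat (Suc r)) (c\<^sup>2)"
proof -
  define a :: complex where "a = 2 ^ Suc r"
  have deg: "degree (hermite_shift r c) = Suc r" "lead_coeff (hermite_shift r c) = a"
    using hermite_shift_degree[of r c] by (auto simp: a_def)
  have deg': "coeff (hermite_shift r c) (Suc r) = a"
    using deg by simp
  obtain \<alpha> where \<alpha>: "roots_of (hermite_shift r c) (Suc r) \<alpha>"
    and d: "disc (hermite_shift r c) = a ^ (2 * Suc r - 2) * (\<Prod>j<Suc r. \<Prod>i<j. (\<alpha> i - \<alpha> j)\<^sup>2)"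
    using disc_obtain_roots[of "hermite_shift r c"] unfolding deg deg' by blast
  define s :: complex where "s = (\<Prod>j<Suc r. (-1) ^ j)"
  define V where "V = (\<Prod>j<Suc r. \<Prod>i<j. (\<alpha> i - \<alpha> j)\<^sup>2)"
  define G where "G = disc_form r (2 * of_nat (Suc r)) (c\<^sup>2 + 2 * of_nat (Suc r)) (c\<^sup>2)"
  have ss: "s * s = 1"
    unfolding s_def by (simp add: prod.distrib[symmetric] power_mult_distrib[symmetric] del: prod.lessThan_Suc)
  have "a ^ Suc r * (s * V) = (\<Prod>i<Suc r. poly (pderiv (hermite_shift r c)) (\<alpha> i))"
    unfolding s_def V_def prod_differences_sign[symmetric]
    by (subst prod.cong[OF refl poly_pderiv_root[OF \<alpha>]]) (simp_all add: prod.distrib deg deg' del: prod.lessThan_Suc power_Suc)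
  also have "\<dots> = G * (\<Prod>k\<le>r. (- 2 * of_nat k) ^ k)"
    by (subst prod.cong[OF refl pderiv_at_root[OF \<alpha>]])
      (simp_all only: lessThan_iff prod.distrib prod_linear_at_roots[OF \<alpha>] prod_hermite_at_roots[OF \<alpha>] G_def)
  also have "(\<Prod>k\<le>r. (- 2 * of_nat k) ^ k) = s * (\<Prod>k\<le>r. (2 * of_nat k) ^ k)"
    unfolding s_def lessThan_Suc_atMost prod.distrib[symmetric] power_mult_distrib[symmetric] by simp
  finally have "s * s * (a ^ Suc r * V) = s * s * (G * (\<Prod>k\<le>r. (2 * of_nat k) ^ k))"
    by (simp add: algebra_simps)
  then have V: "a ^ Suc r * V = G * (\<Prod>k\<le>r. (2 * of_nat k) ^ k)" by (simp add: ss)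
  have "2 * Suc r - 2 = (r - 1) + Suc r" using assms by simp
  then have "disc (hermite_shift r c) = a ^ (r - 1) * (a ^ Suc r * V)"
    unfolding d V_def by (simp only: power_add mult.assoc)
  also have "\<dots> = 2 ^ ((r + 1) * (r - 1)) * (\<Prod>k\<le>r. (2 * of_nat k) ^ k) * G"
    unfolding V by (simp add: a_def power_mult[symmetric] del: power_Suc)
  also have "\<dots> = of_int (disc_const r) * G"
    by (simp add: disc_const_def)
  finally show ?thesis by (simp add: G_def)
qed

section \<open>The discriminant as a polynomial in the shift\<close>

lemma map_poly_of_int_add: "map_poly of_int (p + q) = map_poly of_int p + (map_poly of_int q :: 'a::comm_ring_1 poly)"
  by (intro poly_eqI) (simp add: coeff_map_poly)

lemma map_poly_of_int_diff: "map_poly of_int (p - q) = map_poly of_int p - (map_poly of_int q :: 'a::comm_ring_1 poly)"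
  by (intro poly_eqI) (simp add: coeff_map_poly)

lemma map_poly_of_int_mult: "map_poly of_int (p * q) = map_poly of_int p * (map_poly of_int q :: 'a::comm_ring_1 poly)"
  by (intro poly_eqI) (simp add: coeff_map_poly coeff_mult)

lemma map_poly_of_int_smult: "map_poly of_int (smult c p) = smult (of_int c :: 'a::comm_ring_1) (map_poly of_int p)"
  by (intro poly_eqI) (simp add: coeff_map_poly)

lemma map_poly_of_int_of_nat: "map_poly of_int (of_nat n) = (of_nat n :: 'a::comm_ring_1 poly)"
  by (simp add: of_nat_poly map_poly_pCons)

lemma map_poly_of_int_numeral: "map_poly of_int (numeral n) = (numeral n :: 'a::comm_ring_1 poly)"
  using map_poly_of_int_of_nat[of "numeral n"] by simp

lemmas map_poly_of_int_simps = map_poly_of_int_add map_poly_of_int_diff map_poly_of_int_mult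
  map_poly_of_int_of_nat map_poly_of_int_numeral

lemma poly_of_nat: "poly (of_nat n) x = of_nat n"
  by (simp add: of_nat_poly)

lemma poly_map_hermite_seq:
  "poly (map_poly of_int (hermite_seq p q k)) x = hermite_seq (poly (map_poly of_int p) x) (poly (map_poly of_int q) x) k"
  by (induction p q k rule: hermite_seq.induct)
    (simp_all add: map_poly_of_int_simps poly_of_nat del: of_nat_Suc)

lemma poly_map_disc_form:
  "poly (map_poly of_int (disc_form r m p q)) x =
    disc_form r (poly (map_poly of_int m) x) (poly (map_poly of_int p) x) (poly (map_poly of_int q) x)"
  by (simp add: disc_form_def map_poly_of_int_simps poly_map_hermite_seq poly_of_nat)

definition disc_poly :: "nat \<Rightarrow> int poly" where
  "disc_poly r = smult (disc_const r)
     (disc_form r (of_nat (2 * Suc r)) [:of_nat (2 * Suc r), 0, 1:] [:0, 0, 1:])"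

lemma poly_disc_poly:
  "poly (map_poly of_int (disc_poly r)) x =
    of_int (disc_const r) * disc_form r (2 * of_nat (Suc r)) (x\<^sup>2 + 2 * of_nat (Suc r)) (x\<^sup>2 :: 'a::comm_ring_1)"
  by (simp add: disc_poly_def map_poly_of_int_smult poly_map_disc_form map_poly_pCons map_poly_of_int_mult
      map_poly_of_int_of_nat map_poly_of_int_numeral poly_of_nat power2_eq_square add.commute del: of_nat_Suc mult_Suc_right)

text \<open>
  The sequence is monic of degree \<open>2 * k\<close> in \<open>c\<close>: the factor \<open>p\<close> raises the degree by two in one step, whereas
  \<open>q\<close> does so in two steps.
\<close>

lemma coeff_hermite_seq_poly:
  fixes c :: int
  shows "(\<forall>i>2 * k. coeff (hermite_seq [:c, 0, 1:] [:0, 0, 1:] k) i = 0) \<and> coeff (hermite_seq [:c, 0, 1:] [:0, 0, 1:] k) (2 * k) = 1"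
proof (induction "[:c, 0, 1:]" "[:0, 0, 1 :: int:]" k rule: hermite_seq.induct)
  case 1
  then show ?case by simp
next
  case 2
  then show ?case by (auto simp: coeff_pCons split: nat.splits)
next
  case (3 k)
  then show ?case
    by (auto simp: of_nat_poly numeral_poly coeff_pCons split: nat.splits)
qed

text \<open>
  Both terms of the form have degree \<open>2 * r\<close>; their leading coefficients \<open>2 * (r + 1)\<close> and
  \<open>2 * r\<close> differ by 2.
\<close>

lemma coeff_disc_poly:
  assumes "r > 0"
  shows "degree (disc_poly r) = 2 * r" "coeff (disc_poly r) (2 * r) = 2 * disc_const r"
proof -
  obtain l where l: "r = Suc l" using assms by (cases r) auto
  define h where "h k = hermite_seq [:of_nat (2 * Suc r), 0, 1 :: int:] [:0, 0, 1:] k" for k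
  have h: "i > 2 * k \<Longrightarrow> coeff (h k) i = 0" "coeff (h k) (2 * k) = 1" for k i
    using coeff_hermite_seq_poly[of k "of_nat (2 * Suc r)"] unfolding h_def by blast+
  have G: "disc_poly r = smult (disc_const r) (smult (of_nat (2 * Suc r)) (h r) - smult (2 * of_nat r) (pCons 0 (pCons 0 (h l))))"
    unfolding disc_poly_def disc_form_def h_def l
    by (simp add: of_nat_poly numeral_poly mult.commute del: of_nat_Suc hermite_seq.simps)
  have c: "coeff (disc_poly r) (2 * r) = 2 * disc_const r"
    unfolding G using h(2)[of r] h(2)[of l] by (simp add: l algebra_simps)
  have "coeff (disc_poly r) i = 0" if "i > 2 * r" for i
    unfolding G using h(1)[of r i] h(1)[of l] that by (auto simp: l coeff_pCons split: nat.splits)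
  then have "degree (disc_poly r) \<le> 2 * r" by (intro degree_le) simp
  moreover have "disc_const r \<noteq> 0" by (simp add: disc_const_def)
  then have "2 * r \<le> degree (disc_poly r)" by (intro le_degree) (simp add: c)
  ultimately show "degree (disc_poly r) = 2 * r" by simp
  show "coeff (disc_poly r) (2 * r) = 2 * disc_const r" by (rule c)
qed

text \<open>
  Two integer polynomials with the same values on the infinite field of complex numbers coincide.
\<close>

lemma hermite_disc_poly_eq:
  assumes "r > 0" shows "hermite_disc_poly r = disc_poly r"
  unfolding hermite_disc_poly_def
proof (rule the_equality)
  show D: "\<forall>c. poly (map_poly of_int (disc_poly r)) c = disc (hermite_shift r c)"
    by (simp add: poly_disc_poly disc_hermite_shift[OF assms] del: of_nat_Suc)
  fix F :: "int poly"
  assume "\<forall>c. poly (map_poly of_int F) c = disc (hermite_shift r c)"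
  then have "poly (map_poly of_int F) = (poly (map_poly of_int (disc_poly r)) :: complex \<Rightarrow> complex)"
    using D by (intro ext) simp
  then have eq: "map_poly of_int F = (map_poly of_int (disc_poly r) :: complex poly)"
    by (simp add: poly_eq_poly_eq_iff)
  show "F = disc_poly r"
  proof (rule poly_eqI)
    fix i
    have "of_int (coeff F i) = (of_int (coeff (disc_poly r) i) :: complex)"
      using arg_cong[OF eq, of "\<lambda>p. coeff p i"] by (simp add: coeff_map_poly)
    then show "coeff F i = coeff (disc_poly r) i" by simp
  qed
qed

section \<open>Rational points of the complete curve\<close>

lemma homogenized_eq:
  fixes F :: "'a::field poly"
  assumes "degree F \<le> d" "Z \<noteq> 0"
  shows "(\<Sum>i\<le>d. coeff F i * X ^ i * Z ^ (d - i)) = Z ^ d * poly F (X / Z)"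
proof -
  have "Z ^ d * poly F (X / Z) = (\<Sum>i\<le>d. Z ^ d * (coeff F i * (X / Z) ^ i))"
    unfolding poly_altdef sum_distrib_left[symmetric]
    using assms(1) by (intro arg_cong2[where f = "(*)"] refl sum.mono_neutral_left) (auto simp: coeff_eq_0)
  also have "\<dots> = (\<Sum>i\<le>d. coeff F i * X ^ i * Z ^ (d - i))"
  proof (intro sum.cong refl)
    fix i assume "i \<in> {..d}"
    then have "Z ^ d = Z ^ i * Z ^ (d - i)" by (simp flip: power_add)
    then show "Z ^ d * (coeff F i * (X / Z) ^ i) = coeff F i * X ^ i * Z ^ (d - i)"
      using assms(2) by (simp add: power_divide)
  qed
  finally show ?thesis ..
qed

lemma homogenized_infinity:
  fixes F :: "'a::field poly"
  shows "(\<Sum>i\<le>d. coeff F i * X ^ i * 0 ^ (d - i)) = coeff F d * X ^ d"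
proof -
  have "(\<Sum>i\<le>d. coeff F i * X ^ i * 0 ^ (d - i)) = (\<Sum>i\<in>{d}. coeff F i * X ^ i * 0 ^ (d - i))"
    by (intro sum.mono_neutral_right) auto
  then show ?thesis by simp
qed

lemma homogenized_scale:
  fixes F :: "'a::field poly"
  shows "(\<Sum>i\<le>d. coeff F i * (t * X) ^ i * (t * Z) ^ (d - i)) = t ^ d * (\<Sum>i\<le>d. coeff F i * X ^ i * Z ^ (d - i))"
  unfolding sum_distrib_left
proof (intro sum.cong refl)
  fix i assume "i \<in> {..d}"
  then have "t ^ d = t ^ i * t ^ (d - i)" by (simp flip: power_add)
  then show "coeff F i * (t * X) ^ i * (t * Z) ^ (d - i) = t ^ d * (coeff F i * X ^ i * Z ^ (d - i))"
    by (simp add: power_mult_distrib)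
qed

text \<open>
  A class with \<open>Z \<noteq> 0\<close> contains an affine point with \<open>Z = 1\<close>, one with \<open>Z = 0\<close> contains a point
  with \<open>X = 1\<close>, whose equation involves only the coefficient of degree \<open>2 * r\<close>. The case
  \<open>X = Z = 0\<close> would force \<open>Y = 0\<close>.
\<close>

lemma hyperelliptic_points_nonempty_iff:
  fixes F :: "'a::field poly"
  assumes "r > 0" "degree F \<le> 2 * r"
  shows "hyperelliptic_points r F \<noteq> {} \<longleftrightarrow> (\<exists>x y. y\<^sup>2 = poly F x) \<or> (\<exists>y. y\<^sup>2 = coeff F (2 * r))"
proof -
  let ?S = "\<lambda>X Z. \<Sum>i\<le>2 * r. coeff F i * X ^ i * Z ^ (2 * r - i)"
  have point: "hyperelliptic_points r F \<noteq> {}" if nz: "(X, Y, Z) \<noteq> (0, 0, 0)" and eq: "Y\<^sup>2 = ?S X Z" for X Y Z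
  proof -
    have "weighted_rel r `` {(X, Y, Z)} \<in> weighted_plane r"
      unfolding weighted_plane_def using nz by (intro quotientI) simp
    moreover have "Y'\<^sup>2 = ?S X' Z'" if mem: "(X', Y', Z') \<in> weighted_rel r `` {(X, Y, Z)}" for X' Y' Z'
    proof -
      obtain t where "X' = t * X" "Y' = t ^ r * Y" "Z' = t * Z"
        using mem by (auto simp: weighted_rel_def)
      then show ?thesis
        unfolding homogenized_scale[of F t X Z "2 * r", folded \<open>X' = _\<close> \<open>Z' = _\<close>]
        by (simp add: eq power_mult_distrib power_mult[symmetric] mult.commute[of r 2])
    qed
    ultimately show ?thesis unfolding hyperelliptic_points_def by blast
  qed
  show ?thesis
  proof
    assume "hyperelliptic_points r F \<noteq> {}"
    then obtain P where P: "P \<in> weighted_plane r" "\<forall>(X, Y, Z) \<in> P. Y\<^sup>2 = ?S X Z"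
      unfolding hyperelliptic_points_def by blast
    then obtain X Y Z where nz: "(X, Y, Z) \<noteq> (0, 0, 0)" and PX: "P = weighted_rel r `` {(X, Y, Z)}"
      unfolding weighted_plane_def by (auto elim!: quotientE)
    have "(X, Y, Z) \<in> P"
      unfolding PX weighted_rel_def by (auto intro!: exI[of _ 1])
    then have eq: "Y\<^sup>2 = ?S X Z" using P(2) by blast
    show "(\<exists>x y. y\<^sup>2 = poly F x) \<or> (\<exists>y. y\<^sup>2 = coeff F (2 * r))"
    proof (cases "Z = 0")
      case False
      have "(Y / Z ^ r)\<^sup>2 = poly F (X / Z)"
        using eq False unfolding homogenized_eq[OF assms(2) False]
        by (simp add: power_divide power_mult[symmetric] mult.commute)
      then show ?thesis by blast
    next
      case True
      then have eq': "Y\<^sup>2 = coeff F (2 * r) * X ^ (2 * r)"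
        using eq by (simp add: homogenized_infinity)
      then have "X \<noteq> 0" using nz True assms(1) by (auto simp: power_0_left)
      then have "(Y / X ^ r)\<^sup>2 = coeff F (2 * r)"
        using eq' by (simp add: power_divide power_mult[symmetric] mult.commute)
      then show ?thesis by blast
    qed
  next
    assume "(\<exists>x y. y\<^sup>2 = poly F x) \<or> (\<exists>y. y\<^sup>2 = coeff F (2 * r))"
    then show "hyperelliptic_points r F \<noteq> {}"
    proof (elim disjE exE)
      fix x y assume "y\<^sup>2 = poly F x"
      then show ?thesis
        using homogenized_eq[OF assms(2), of 1 x] by (intro point[of x y 1]) simp_all
    next
      fix y assume "y\<^sup>2 = coeff F (2 * r)"
      then show ?thesis
        using homogenized_infinity[of F 1 "2 * r"] by (intro point[of 1 y 0]) simp_all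
    qed
  qed
qed

section \<open>Arithmetic of the 2-adic integers\<close>

lemma residue_nonneg [simp]: "0 \<le> residue x n"
  and residue_less [simp]: "residue x n < 2 ^ n"
  using residue[of x] by auto

lemma residue_plus: "residue (x + y) n = (residue x n + residue y n) mod 2 ^ n"
  by (simp add: plus_two_adic_int.rep_eq)

lemma residue_minus: "residue (x - y) n = (residue x n - residue y n) mod 2 ^ n"
  by (simp add: minus_two_adic_int.rep_eq)

lemma residue_times: "residue (x * y) n = (residue x n * residue y n) mod 2 ^ n"
  by (simp add: times_two_adic_int.rep_eq)

lemma residue_0 [simp]: "residue 0 n = 0"
  by (simp add: zero_two_adic_int.rep_eq)

lemma residue_of_nat: "residue (of_nat m) n = int m mod 2 ^ n"
  by (induction m) (simp_all add: residue_plus one_two_adic_int.rep_eq mod_simps add.commute)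

instance two_adic_int :: ring_char_0
proof
  show "inj (of_nat :: nat \<Rightarrow> two_adic_int)"
  proof (rule injI)
    fix m n :: nat
    assume eq: "(of_nat m :: two_adic_int) = of_nat n"
    have "int m + int n < 2 ^ (m + n)"
      using of_nat_less_two_power[of "m + n", where 'a = int] by simp
    then have "int m < 2 ^ (m + n)" "int n < 2 ^ (m + n)"
      by linarith+
    moreover have "int m mod 2 ^ (m + n) = int n mod 2 ^ (m + n)"
      by (simp only: residue_of_nat[symmetric] eq)
    ultimately show "m = n"
      by (simp only: mod_pos_pos_trivial of_nat_0_le_iff of_nat_eq_iff)
  qed
qed

lemma residue_of_int: "residue (of_int m) n = m mod 2 ^ n"
proof -
  have "residue (of_nat (nat m) - of_nat (nat (- m))) n = m mod 2 ^ n"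
    by (simp add: residue_minus residue_of_nat mod_simps)
  moreover have "of_nat (nat m) - of_nat (nat (- m)) = (of_int m :: two_adic_int)"
    by (cases "m \<ge> 0") simp_all
  ultimately show ?thesis by simp
qed

lemma residue_eqI: "(\<And>n. residue x n = residue y n) \<Longrightarrow> x = y"
  by (metis residue_inject ext)

text \<open>
  The quotient is obtained by shifting the sequence of residues by \<open>k\<close> places and dividing each of them by
  \<open>2 ^ k\<close>.
\<close>

lemma pow2_dvd_iff: "2 ^ k dvd x \<longleftrightarrow> residue x k = 0"
proof
  assume "2 ^ k dvd x"
  then obtain y where "x = of_int (2 ^ k) * y" by (auto elim: dvdE)
  then show "residue x k = 0" by (simp only: residue_times residue_of_int) simp
next
  assume 0: "residue x k = 0"
  have shift: "residue x (Suc n + k) div 2 ^ k mod 2 ^ n = residue x (n + k) div 2 ^ k" for n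
  proof -
    have "residue x (n + k) = residue x (Suc n + k) mod (2 ^ k * 2 ^ n)"
      using residue_mod[of "n + k" "Suc n + k" x] by (simp add: power_add mult.commute)
    also have "\<dots> div 2 ^ k = residue x (Suc n + k) div 2 ^ k mod 2 ^ n"
      by (subst zmod_zmult2_eq) simp_all
    finally show ?thesis by simp
  qed
  have range: "residue x (n + k) div 2 ^ k \<in> {0..<2 ^ n}" for n
    by (subst shift[symmetric]) simp
  define y where "y = Abs_two_adic_int (\<lambda>n. residue x (n + k) div 2 ^ k)"
  have y: "residue y n = residue x (n + k) div 2 ^ k" for n
    unfolding y_def
    by (subst Abs_two_adic_int_inverse) (use shift range in auto)
  have "x = of_int (2 ^ k) * y"
  proof (rule residue_eqI)
    fix n
    have "residue x (n + k) mod 2 ^ k = 0"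
      using residue_mod[of k "n + k" x] 0 by simp
    then have "2 ^ k * (residue x (n + k) div 2 ^ k) = residue x (n + k)"
      by (simp add: mult_div_mod_eq[symmetric] dvd_eq_mod_eq_0)
    then show "residue x n = residue (of_int (2 ^ k) * y) n"
      using residue_mod[of n "n + k" x] by (simp add: residue_times residue_of_int y mod_simps del: of_int_power)
  qed
  then show "2 ^ k dvd x" by simp
qed

lemma eq_if_pow2_dvd: "(\<And>k. 2 ^ k dvd x - y) \<Longrightarrow> x = (y :: two_adic_int)"
  by (metis eq_iff_diff_eq_0 pow2_dvd_iff residue_0 residue_eqI)

lemma residue_cong_dvd: "2 ^ k dvd x - y \<longleftrightarrow> residue x k = residue y k"
proof -
  have "2 ^ k dvd x - y \<longleftrightarrow> residue x k mod 2 ^ k = residue y k mod 2 ^ k"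
    by (simp only: pow2_dvd_iff residue_minus mod_eq_0_iff_dvd mod_eq_dvd_iff)
  then show ?thesis by simp
qed

text \<open>
  Completeness of the 2-adic integers in the form in which it is used: the iterates of \<open>0\<close> agree
  modulo growing powers of two. Both inverses and square roots are fixed points of such maps.
\<close>

lemma contraction_fixed_point:
  fixes T :: "two_adic_int \<Rightarrow> two_adic_int"
  assumes "\<And>k x y. 2 ^ k dvd x - y \<Longrightarrow> 2 ^ Suc k dvd T x - T y"
  shows "\<exists>x. T x = x"
proof -
  define w where "w k = (T ^^ k) 0" for k
  have w: "2 ^ k dvd w (Suc k) - w k" for k
    by (induction k) (simp, use assms in \<open>simp add: w_def\<close>)
  have step: "residue (w (Suc k)) k = residue (w k) k" for k
    using w[of k] by (simp only: residue_cong_dvd)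
  define x where "x = Abs_two_adic_int (\<lambda>k. residue (w k) k)"
  have x: "residue x k = residue (w k) k" for k
    unfolding x_def
    by (subst Abs_two_adic_int_inverse) (use step residue_mod[of _ "Suc _"] in auto)
  have "residue (T x) k = residue x k" for k
  proof -
    have "2 ^ k dvd x - w k" by (simp add: residue_cong_dvd x)
    then have "2 ^ Suc k dvd T x - w (Suc k)" using assms by (simp add: w_def)
    then have "2 ^ k dvd T x - w (Suc k)" by (rule dvd_trans[rotated]) (simp add: le_imp_power_dvd)
    then show ?thesis by (simp add: residue_cong_dvd step x)
  qed
  then show ?thesis using residue_eqI by blast
qed

lemma odd_two_adic: "\<not> 2 dvd x \<longleftrightarrow> 2 dvd x - (1 :: two_adic_int)"
proof -
  have "residue x 1 = 0 \<or> residue x 1 = 1" using residue_nonneg[of x 1] residue_less[of x 1] unfolding power_one_right by linarith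
  moreover have "residue 1 1 = 1" by (simp add: one_two_adic_int.rep_eq)
  ultimately show ?thesis
    using pow2_dvd_iff[of 1 x] residue_cong_dvd[of 1 x 1] by auto
qed

lemma odd_obtain: assumes "\<not> 2 dvd x" obtains y where "x = 1 + 2 * (y :: two_adic_int)"
proof -
  obtain y where "x - 1 = 2 * y" using assms odd_two_adic by (blast elim: dvdE)
  then show ?thesis using that[of y] by (simp add: diff_eq_eq add.commute)
qed

text \<open>
  The square of \<open>1 + 2 * y\<close> is \<open>1 + 4 * y * (y + 1)\<close>, and one of \<open>y\<close> and \<open>y + 1\<close> is even.
\<close>

lemma odd_square: assumes "\<not> 2 dvd (x :: two_adic_int)" shows "8 dvd x\<^sup>2 - 1"
proof -
  obtain y where y: "x = 1 + 2 * y" using odd_obtain[OF assms] .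
  have "2 dvd y * (y + 1)"
    using odd_two_adic[of y] odd_two_adic[of "y + 1"] by auto
  then obtain z where z: "y * (y + 1) = 2 * z" by (elim dvdE)
  have "x\<^sup>2 - 1 = 4 * (y * (y + 1))" unfolding y by (simp add: algebra_simps power2_eq_square)
  also have "\<dots> = 8 * z" unfolding z by simp
  finally show ?thesis by simp
qed

text \<open>
  The inverse \<open>w\<close> of \<open>1 + 2 * y\<close> is the fixed point of \<open>w \<mapsto> 1 - 2 * y * w\<close>.
\<close>

lemma odd_unit: assumes "\<not> 2 dvd (x :: two_adic_int)" shows "x dvd 1"
proof -
  obtain y where y: "x = 1 + 2 * y" using odd_obtain[OF assms] .
  have "\<exists>w. 1 - 2 * y * w = w"
  proof (rule contraction_fixed_point)
    fix k and a b :: two_adic_int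
    assume "2 ^ k dvd a - b"
    then have "2 * 2 ^ k dvd 2 * (a - b) * - y" by (intro dvd_mult2 mult_dvd_mono) auto
    then show "2 ^ Suc k dvd (1 - 2 * y * a) - (1 - 2 * y * b)" by (simp add: algebra_simps)
  qed
  then obtain w where "1 - 2 * y * w = w" ..
  then have "1 = x * w" unfolding y by (simp add: algebra_simps)
  then show ?thesis by (rule dvdI)
qed

text \<open>
  For \<open>a = 1 + 8 * b\<close> a square root \<open>1 + 4 * w\<close> is sought; the equation becomes \<open>w = b - 2 * w\<^sup>2\<close>, whose
  right-hand side is a contraction.
\<close>

lemma square_if_cong_1:
  assumes "8 dvd a - (1 :: two_adic_int)" shows "\<exists>z. a = z\<^sup>2"
proof -
  obtain b where b: "a - 1 = 8 * b" using assms by (elim dvdE)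
  have "\<exists>w. b - 2 * w\<^sup>2 = w"
  proof (rule contraction_fixed_point)
    fix k and x y :: two_adic_int
    assume "2 ^ k dvd x - y"
    then have "2 * 2 ^ k dvd 2 * (x - y) * - (x + y)" by (intro dvd_mult2 mult_dvd_mono) auto
    then show "2 ^ Suc k dvd (b - 2 * x\<^sup>2) - (b - 2 * y\<^sup>2)" by (simp add: algebra_simps power2_eq_square)
  qed
  then obtain w where "b - 2 * w\<^sup>2 = w" ..
  then have b': "b = w + 2 * w\<^sup>2" by (simp add: algebra_simps)
  have "a = 1 + 8 * b" using b by (simp add: algebra_simps)
  then have "a = (1 + 4 * w)\<^sup>2" unfolding b' by (simp add: algebra_simps power2_eq_square)
  then show ?thesis ..
qed

lemma nonzero_decomp:
  fixes x :: two_adic_int assumes "x \<noteq> 0"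
  obtains k u where "x = 2 ^ k * u" "\<not> 2 dvd u"
proof -
  obtain n where n: "\<not> 2 ^ n dvd x" using assms eq_if_pow2_dvd[of x 0] by auto
  have "\<exists>k u. x = 2 ^ k * u \<and> \<not> 2 dvd u" if "\<not> 2 ^ n dvd x" for x :: two_adic_int
    using that
  proof (induction n arbitrary: x)
    case (Suc n)
    show ?case
    proof (cases "2 dvd x")
      case True
      then obtain y where y: "x = 2 * y" by (elim dvdE)
      then have "\<not> 2 ^ n dvd y" using Suc.prems by (auto intro: mult_dvd_mono)
      then obtain k u where "y = 2 ^ k * u" "\<not> 2 dvd u" using Suc.IH by blast
      then show ?thesis unfolding y by (intro exI[of _ "Suc k"] exI[of _ u]) simp
    next
      case False
      then show ?thesis by (intro exI[of _ 0] exI[of _ x]) simp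
    qed
  qed simp
  then show ?thesis using n that by blast
qed

lemma two_dvd_mult: "2 dvd x * (y :: two_adic_int) \<longleftrightarrow> 2 dvd x \<or> 2 dvd y"
proof -
  have "2 dvd x \<or> 2 dvd y" if xy: "2 dvd x * y"
  proof (rule ccontr)
    assume "\<not> ?thesis"
    then obtain a where "x = 1 + 2 * a" and y: "\<not> 2 dvd y" using odd_obtain by blast
    then have "y = x * y - 2 * (a * y)" by (simp add: algebra_simps)
    then show False using xy y by (metis dvd_diff dvd_triv_left)
  qed
  then show ?thesis by auto
qed

section \<open>Square classes of 2-adic numbers\<close>

text \<open>
  Elements of valuation at most 1 that a residue modulo 8 certifies to be nonsquares.
\<close>

definition nonsquare_res :: "two_adic_int \<Rightarrow> bool" where
  "nonsquare_res u \<longleftrightarrow> \<not> 4 dvd u \<and> \<not> 8 dvd u - 1"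

text \<open>
  Strip the powers of two from \<open>a\<close> and \<open>b\<close>. If the exponents agree, \<open>q\<close> is congruent to 1 modulo 8,
  because odd squares are; if \<open>a\<close> has the larger exponent, 4 divides \<open>q\<close>; if \<open>b\<close> does, an odd
  number would be even.
\<close>

lemma nonsquare_integral:
  assumes "nonsquare_res q" "a \<noteq> 0" "b \<noteq> 0" shows "a\<^sup>2 \<noteq> q * b\<^sup>2"
proof
  assume eq: "a\<^sup>2 = q * b\<^sup>2"
  obtain i u where a: "a = 2 ^ i * u" "\<not> 2 dvd u" using nonzero_decomp[OF assms(2)] .
  obtain j v where b: "b = 2 ^ j * v" "\<not> 2 dvd v" using nonzero_decomp[OF assms(3)] .
  have sq4: "(2 ^ k)\<^sup>2 = (4 ^ k :: two_adic_int)" for k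
    by (simp add: power2_eq_square flip: power_mult_distrib)
  have eq': "4 ^ i * u\<^sup>2 = q * (4 ^ j * v\<^sup>2)"
    using eq sq4 unfolding a b power_mult_distrib by simp
  have u: "\<not> 2 dvd u\<^sup>2" and v: "\<not> 2 dvd v\<^sup>2" using a b by (simp_all add: power2_eq_square two_dvd_mult)
  consider "i = j" | d where "i = j + Suc d" | d where "j = i + Suc d"
    by (metis add_Suc_right less_imp_Suc_add linorder_neqE_nat)
  then show False
  proof cases
    case 1
    then have e: "u\<^sup>2 = q * v\<^sup>2" using eq' by (simp add: mult.left_commute[of q])
    have "u\<^sup>2 - 1 - q * (v\<^sup>2 - 1) = q - 1" by (simp add: e algebra_simps)
    then have "8 dvd q - 1" using odd_square[OF a(2)] odd_square[OF b(2)] by (metis dvd_diff dvd_mult)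
    then show False using assms(1) by (simp add: nonsquare_res_def)
  next
    case 2
    then have "4 ^ Suc d * u\<^sup>2 = q * v\<^sup>2" using eq' by (simp add: power_add mult.left_commute[of q] mult.assoc)
    then have "4 dvd q * v\<^sup>2" by (metis dvd_mult2 dvd_triv_left power_Suc)
    moreover obtain w where "1 = v\<^sup>2 * w" using odd_unit[OF v] by (elim dvdE)
    ultimately have "4 dvd q" by (metis dvd_mult2 mult.assoc mult_1_right)
    then show False using assms(1) by (simp add: nonsquare_res_def)
  next
    case 3
    then have "u\<^sup>2 = q * (4 ^ Suc d * v\<^sup>2)" using eq' by (simp add: power_add mult.left_commute)
    also have "\<dots> = 2 * (2 * q * 4 ^ d * v\<^sup>2)" by simp
    finally show False using u by (metis dvd_triv_left)
  qed
qed

text \<open>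
  The representative \<open>u\<close> is taken integral, so that its residues modulo powers of two decide whether \<open>q\<close> is a
  square. It is not unique, and \<open>q = u = 0\<close> is allowed.
\<close>

definition sqclass :: "two_adic \<Rightarrow> two_adic_int \<Rightarrow> bool" where
  "sqclass q u \<longleftrightarrow> (\<exists>v. v \<noteq> 0 \<and> q = to_fract u * v\<^sup>2)"

lemma to_fract_power: "to_fract (x ^ n) = to_fract x ^ n"
  by (induction n) simp_all

lemma to_fract_of_nat: "to_fract (of_nat n) = of_nat n"
  by (induction n) simp_all

lemma to_fract_of_int: "to_fract (of_int n) = of_int n"
  by (cases n) (simp_all add: to_fract_of_nat del: of_nat_Suc)

lemma to_fract_numeral: "to_fract (numeral n) = numeral n"
  using to_fract_of_nat[of "numeral n"] by simp

lemma fract_decomp: obtains a b where "x = to_fract a / to_fract b" "b \<noteq> 0"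
  by (cases x) (metis Fract_conv_to_fract)

lemma sqclass_nonsquare:
  assumes "sqclass q u" "nonsquare_res u" shows "q \<noteq> y\<^sup>2"
proof
  assume "q = y\<^sup>2"
  moreover obtain v where v: "v \<noteq> 0" "q = to_fract u * v\<^sup>2" using assms(1) by (auto simp: sqclass_def)
  ultimately have yv: "(y / v)\<^sup>2 = to_fract u" by (auto simp: power_divide divide_eq_eq)
  obtain a b where ab: "y / v = to_fract a / to_fract b" "b \<noteq> 0" by (rule fract_decomp)
  have "to_fract (a\<^sup>2) = to_fract (u * b\<^sup>2)"
    using yv ab(2) unfolding ab(1) by (simp add: power_divide to_fract_power divide_eq_eq)
  then have eq: "a\<^sup>2 = u * b\<^sup>2" by (simp only: to_fract_eq_iff)
  have "u \<noteq> 0" using assms(2) by (auto simp: nonsquare_res_def)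
  then have "a \<noteq> 0" using eq ab(2) by auto
  then show False using nonsquare_integral[OF assms(2) _ ab(2)] eq by blast
qed

lemma sqclass_to_fract: "sqclass (to_fract u) u"
  unfolding sqclass_def by (intro exI[of _ 1]) simp

lemma sqclass_mult: "sqclass p u \<Longrightarrow> sqclass q v \<Longrightarrow> sqclass (p * q) (u * v)"
  unfolding sqclass_def
proof (elim exE conjE)
  fix a b
  assume "a \<noteq> 0" "b \<noteq> 0" "p = to_fract u * a\<^sup>2" "q = to_fract v * b\<^sup>2"
  then show "\<exists>v'. v' \<noteq> 0 \<and> p * q = to_fract (u * v) * v'\<^sup>2"
    by (intro exI[of _ "a * b"]) (simp add: power_mult_distrib)
qed

lemma sqclass_strip: "s \<noteq> 0 \<Longrightarrow> sqclass q (s\<^sup>2 * u) \<Longrightarrow> sqclass q u"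
proof -
  assume s: "s \<noteq> 0" and "sqclass q (s\<^sup>2 * u)"
  then obtain v where "v \<noteq> 0" "q = to_fract (s\<^sup>2 * u) * v\<^sup>2" by (auto simp: sqclass_def)
  then have "to_fract s * v \<noteq> 0" "q = to_fract u * (to_fract s * v)\<^sup>2"
    using s by (simp_all add: power_mult_distrib to_fract_power)
  then show ?thesis unfolding sqclass_def by blast
qed

lemma sqclass_square: "sqclass q (s\<^sup>2) \<Longrightarrow> \<exists>y. y\<^sup>2 = q"
  unfolding sqclass_def by (elim exE conjE) (metis power_mult_distrib to_fract_power)

lemma sqclass_of_int: "c \<noteq> 0 \<Longrightarrow> sqclass (of_int (c\<^sup>2 * u)) (of_int u)"
proof -
  assume "c \<noteq> 0"
  then have "to_fract (of_int c) \<noteq> (0 :: two_adic)" by simp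
  moreover have "of_int (c\<^sup>2 * u) = to_fract (of_int u) * (to_fract (of_int c) :: two_adic)\<^sup>2"
    by (simp add: to_fract_of_int mult.commute)
  ultimately show ?thesis unfolding sqclass_def by blast
qed

text \<open>
  A nonzero 2-adic number is a power of two times a unit. Units belong to the second case because the discriminant
  is divided by a power of \<open>x\<^sup>2\<close> whenever \<open>1 / x\<^sup>2\<close> is integral.
\<close>

lemma fract_integral_cases:
  obtains a where "x = to_fract a" "2 dvd a" | a where "a \<noteq> 0" "x = inverse (to_fract (a :: two_adic_int))"
proof (cases "x = 0")
  case True
  then show ?thesis using that(1)[of 0] by simp
next
  case False
  obtain a b where x: "x = to_fract a / to_fract b" "b \<noteq> 0" by (rule fract_decomp)
  then have "a \<noteq> 0" using False by auto
  obtain i u where a: "a = 2 ^ i * u" "\<not> 2 dvd u" using nonzero_decomp[OF \<open>a \<noteq> 0\<close>] .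
  obtain j v where b: "b = 2 ^ j * v" "\<not> 2 dvd v" using nonzero_decomp[OF x(2)] .
  obtain u' where u': "1 = u * u'" using odd_unit[OF a(2)] by (elim dvdE)
  obtain v' where v': "1 = v * v'" using odd_unit[OF b(2)] by (elim dvdE)
  show ?thesis
  proof (cases "j < i")
    case True
    then obtain d where d: "i = Suc d + j" using less_imp_Suc_add by (metis add.commute add_Suc_right)
    have "a = b * (2 * (2 ^ d * (u * v')))"
    proof -
      have "b * (2 * (2 ^ d * (u * v'))) = 2 ^ i * u * (v * v')" unfolding b(1) d power_add power_Suc by (simp only: mult_ac)
      then show ?thesis by (simp only: a(1) v'[symmetric] mult_1_right)
    qed
    then have "to_fract a = to_fract b * to_fract (2 * (2 ^ d * (u * v')))" by (simp only: to_fract_mult)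
    then have "x = to_fract (2 * (2 ^ d * (u * v')))" using x by simp
    then show ?thesis using that(1) by (metis dvd_triv_left)
  next
    case False
    then obtain d where d: "j = d + i" by (metis add.commute le_Suc_ex not_less)
    have "b = a * (2 ^ d * (v * u'))"
    proof -
      have "a * (2 ^ d * (v * u')) = 2 ^ j * v * (u * u')" unfolding a(1) d power_add by (simp only: mult_ac)
      then show ?thesis by (simp only: b(1) u'[symmetric] mult_1_right)
    qed
    moreover from this have "2 ^ d * (v * u') \<noteq> 0" using x(2) by auto
    ultimately have "x = inverse (to_fract (2 ^ d * (v * u')))"
      using x \<open>a \<noteq> 0\<close> by (simp add: divide_simps del: mult_eq_0_iff)
    then show ?thesis using that(2) \<open>2 ^ d * (v * u') \<noteq> 0\<close> by blast
  qed
qed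

section \<open>Residues of the Hermite sequence\<close>

lemma residue_1: "residue 1 n = 1 mod 2 ^ n"
  by (simp add: one_two_adic_int.rep_eq)

lemma residue_numeral: "residue (numeral w) n = numeral w mod 2 ^ n"
  using residue_of_nat[of "numeral w" n] by simp

lemmas residue_simps = residue_plus residue_minus residue_times residue_of_nat residue_of_int residue_1 residue_numeral

lemma odd_iff_residue: "0 < k \<Longrightarrow> \<not> 2 dvd x \<longleftrightarrow> odd (residue x k)"
  using pow2_dvd_iff[of 1 x] residue_mod[of 1 k x] by (auto simp: even_iff_mod_2_eq_zero)

lemma residue2_cases: "residue x 2 \<in> {0, 1, 2, 3}"
  using residue_nonneg[of x 2] residue_less[of x 2] by (simp del: residue_nonneg residue_less) presburger

lemma odd_residue2_cases: "\<not> 2 dvd x \<Longrightarrow> residue x 2 \<in> {1, 3}"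
  using residue2_cases[of x] odd_iff_residue[of 2 x] by auto

lemma odd_square_residue: "\<not> 2 dvd x \<Longrightarrow> residue (x\<^sup>2) 3 = 1 \<and> residue (x\<^sup>2) 2 = 1"
  using odd_square[of x] residue_cong_dvd[of 3 "x\<^sup>2" 1] residue_mod[of 2 3 "x\<^sup>2"] by (simp add: residue_1)

lemma nonsquare_resI: "residue u 3 \<in> {2, 3, 5, 6, 7} \<Longrightarrow> nonsquare_res u"
  using residue_cong_dvd[of 3 u 1] pow2_dvd_iff[of 2 u] residue_mod[of 2 3 u]
  by (auto simp: nonsquare_res_def residue_1)

lemma nonsquare_resI_mod4: "residue u 2 \<in> {2, 3} \<Longrightarrow> nonsquare_res u"
  using residue_mod[of 2 3 u] residue_nonneg[of u 3] residue_less[of u 3]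
  by (intro nonsquare_resI) (simp del: residue_nonneg residue_less, presburger)

lemma nonsquare_res_2_odd: "\<not> 2 dvd u \<Longrightarrow> nonsquare_res (2 * u)"
  using odd_residue2_cases[of u] by (intro nonsquare_resI_mod4) (auto simp: residue_simps)

text \<open>
  Modulo 4 one has \<open>p\<^sup>2 = 1\<close>, and all terms are odd. So the recursion multiplies by \<open>p\<close> and subtracts
  \<open>2 * q\<close> or \<open>0\<close>, the coefficient being \<open>2 * (2 * j + 1) * q\<close> or \<open>2 * (2 * j + 2) * q\<close>.
\<close>

lemma hermite_seq_residue4:
  assumes "\<not> 2 dvd p"
  shows "residue (hermite_seq p q (2 * j)) 2 = (1 + 2 * residue q 2 * int j) mod 4 \<and>
    residue (hermite_seq p q (Suc (2 * j))) 2 = (residue p 2 + 2 * residue q 2 * int j) mod 4"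
proof (induction j)
  case 0
  then show ?case using residue_mod[of 2 2 p] by (simp add: residue_1)
next
  case (Suc j)
  have 1: "residue (hermite_seq p q (2 * Suc j)) 2 =
      (residue p 2 * residue (hermite_seq p q (Suc (2 * j))) 2 - 2 * residue q 2 * residue (hermite_seq p q (2 * j)) 2) mod 4"
    by (simp add: residue_simps mod_simps)
  have 2: "residue (hermite_seq p q (Suc (2 * Suc j))) 2 =
      (residue p 2 * residue (hermite_seq p q (2 * Suc j)) 2) mod 4"
  proof -
    have "hermite_seq p q (Suc (2 * Suc j)) = p * hermite_seq p q (2 * Suc j) - 4 * (of_nat (Suc j) * q * hermite_seq p q (Suc (2 * j)))"
      using hermite_seq_Suc[of p q "2 * Suc j"] by (simp add: mult.assoc del: hermite_seq.simps)
    then show ?thesis by (simp add: residue_simps mod_simps del: hermite_seq.simps mult_Suc_right)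
  qed
  have "odd (residue p 2)" using assms by (simp add: odd_iff_residue[of 2])
  then obtain a where a: "residue p 2 = 2 * a + 1" by (elim oddE)
  have even: "residue (hermite_seq p q (2 * Suc j)) 2 = (1 + 2 * residue q 2 * int (Suc j)) mod 4"
  proof -
    define Q where "Q = residue q 2"
    have "residue (hermite_seq p q (2 * Suc j)) 2 = ((2 * a + 1) * (2 * a + 1 + 2 * Q * int j) - 2 * Q * (1 + 2 * Q * int j)) mod 4"
      unfolding 1 Suc[THEN conjunct1] Suc[THEN conjunct2] a Q_def
      by (intro mod_diff_cong mod_mult_cong refl mod_mod_trivial)
    also have "\<dots> = (1 + 2 * Q * int (Suc j)) mod 4"
      unfolding mod_eq_dvd_iff
      \<comment> \<open>a quarter of the difference, from \<open>p\<^sup>2 - 1 = 4 * (a * a + a)\<close> for \<open>p = 2 * a + 1\<close>\<close>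
      by (rule dvdI[of _ _ "a * a + a + a * Q * int j - Q - Q * Q * int j"]) (simp add: algebra_simps)
    finally show ?thesis by (simp only: Q_def)
  qed
  moreover have "residue (hermite_seq p q (Suc (2 * Suc j))) 2 = (residue p 2 + 2 * residue q 2 * int (Suc j)) mod 4"
  proof -
    define Q where "Q = residue q 2"
    have "residue (hermite_seq p q (Suc (2 * Suc j))) 2 = ((2 * a + 1) * (1 + 2 * Q * int (Suc j))) mod 4"
      unfolding 2 even a Q_def
      by (intro mod_diff_cong mod_mult_cong refl mod_mod_trivial)
    also have "\<dots> = (2 * a + 1 + 2 * Q * int (Suc j)) mod 4"
      unfolding mod_eq_dvd_iff by (rule dvdI[of _ _ "a * Q * int (Suc j)"]) (simp add: algebra_simps)
    finally show ?thesis by (simp only: Q_def a)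
  qed
  ultimately show ?case by simp
qed

lemma hermite_seq_odd: "\<not> 2 dvd p \<Longrightarrow> \<not> 2 dvd hermite_seq p q k" for p q :: two_adic_int
proof (cases "even k")
  case True
  assume "\<not> 2 dvd p"
  then show ?thesis
    using hermite_seq_residue4[of p q "k div 2"] True by (simp add: odd_iff_residue[of 2] dvd_mod_iff)
next
  case False
  assume "\<not> 2 dvd p"
  then show ?thesis
    using hermite_seq_residue4[of p q "k div 2"] False by (simp add: odd_iff_residue[of 2] dvd_mod_iff)
qed

lemma disc_form_odd:
  fixes m p q :: two_adic_int
  assumes "\<not> 2 dvd m" "\<not> 2 dvd p" shows "\<not> 2 dvd disc_form r m p q"
proof -
  have "\<not> 2 dvd m * hermite_seq p q r" using assms hermite_seq_odd two_dvd_mult by blast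
  moreover have "2 dvd 2 * of_nat r * q * hermite_seq p q (r - 1)" by simp
  ultimately show ?thesis unfolding disc_form_def by (metis dvd_add diff_add_cancel)
qed

text \<open>
  For even \<open>p = 2 * t\<close> the terms of the sequence become divisible by growing powers of two. These are the
  cofactors at even and at odd indices; besides \<open>q\<close> they depend only on \<open>x = t\<^sup>2\<close>. In the last equation the
  bracket is \<open>even_part x q (Suc j)\<close>, expanded to make the recursion structural.
\<close>

fun even_part :: "'a::comm_ring_1 \<Rightarrow> 'a \<Rightarrow> nat \<Rightarrow> 'a" and odd_part :: "'a \<Rightarrow> 'a \<Rightarrow> nat \<Rightarrow> 'a" where
  "even_part x q 0 = 1"
| "even_part x q (Suc j) = 2 * x * odd_part x q j - of_nat (2 * j + 1) * q * even_part x q j"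
| "odd_part x q 0 = 1"
| "odd_part x q (Suc j) = (2 * x * odd_part x q j - of_nat (2 * j + 1) * q * even_part x q j) - 2 * of_nat (Suc j) * q * odd_part x q j"

lemma hermite_seq_double:
  "hermite_seq (2 * t) q (2 * j) = 2 ^ j * even_part (t\<^sup>2) q j \<and> hermite_seq (2 * t) q (Suc (2 * j)) = 2 ^ Suc j * t * odd_part (t\<^sup>2) q j"
proof (induction j)
  case (Suc j)
  have 1: "hermite_seq (2 * t) q (2 * Suc j) = 2 ^ Suc j * even_part (t\<^sup>2) q (Suc j)"
    using Suc by (simp add: algebra_simps power2_eq_square)
  have "hermite_seq (2 * t) q (Suc (2 * Suc j)) = 2 * t * hermite_seq (2 * t) q (2 * Suc j) - 2 * of_nat (2 * Suc j) * q * hermite_seq (2 * t) q (Suc (2 * j))"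
    using hermite_seq_Suc[of "2 * t" q "2 * Suc j"] by simp
  also have "\<dots> = 2 ^ Suc (Suc j) * t * (even_part (t\<^sup>2) q (Suc j) - 2 * of_nat (Suc j) * q * odd_part (t\<^sup>2) q j)"
    unfolding 1 using Suc by (simp add: algebra_simps del: even_part.simps)
  finally show ?case using 1 by simp
qed simp

lemma disc_form_double:
  "disc_form (Suc (2 * k)) m (2 * t) q = 2 ^ Suc k * (m * t * odd_part (t\<^sup>2) q k - of_nat (2 * k + 1) * q * even_part (t\<^sup>2) q k)"
  unfolding disc_form_def using hermite_seq_double[of t q k] by (simp add: algebra_simps)

text \<open>
  Modulo 8 the coefficients \<open>2 * j + 1\<close> and \<open>2 * (j + 1)\<close> have period 4 in \<open>j\<close>, and the pair of cofactors runs
  through the cycle \<open>(1, 1), (1, 7), (3, 7), (7, 5)\<close>.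
\<close>

lemma even_odd_part_residue8:
  assumes "residue x 3 = 1" "residue q 3 = 1"
  shows "residue (even_part x q (4 * i)) 3 = 1 \<and> residue (odd_part x q (4 * i)) 3 = 1 \<and>
     residue (even_part x q (Suc (4 * i))) 3 = 1 \<and> residue (odd_part x q (Suc (4 * i))) 3 = 7"
proof -
  define e o' where "e j = residue (even_part x q j) 3" and "o' j = residue (odd_part x q j) 3" for j
  have "e (Suc j) = (2 * o' j - (1 + 2 * int j) * e j) mod 8" for j
    by (simp add: e_def o'_def assms residue_simps mod_simps)
  also have "\<dots> j = (2 * o' j - (1 + 2 * int j) mod 8 * e j) mod 8" for j
    by (intro mod_diff_cong mod_mult_cong refl mod_mod_trivial[symmetric])
  finally have e: "e (Suc j) = (2 * o' j - (1 + 2 * int j) mod 8 * e j) mod 8" for j .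
  have "o' (Suc j) = (2 * o' j - (1 + 2 * int j) * e j - (2 + 2 * int j) * o' j) mod 8" for j
    by (simp add: e_def o'_def assms residue_simps mod_simps)
  also have "\<dots> j = (2 * o' j - (1 + 2 * int j) mod 8 * e j - (2 + 2 * int j) mod 8 * o' j) mod 8" for j
    by (intro mod_diff_cong mod_mult_cong refl mod_mod_trivial[symmetric])
  finally have o': "o' (Suc j) = (2 * o' j - (1 + 2 * int j) mod 8 * e j - (2 + 2 * int j) mod 8 * o' j) mod 8" for j .
  have c: "(1 + 2 * int (4 * i)) mod 8 = 1" "(2 + 2 * int (4 * i)) mod 8 = 2"
    "(1 + 2 * int (Suc (4 * i))) mod 8 = 3" "(2 + 2 * int (Suc (4 * i))) mod 8 = 4"
    "(1 + 2 * int (Suc (Suc (4 * i)))) mod 8 = 5" "(2 + 2 * int (Suc (Suc (4 * i)))) mod 8 = 6"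
    "(1 + 2 * int (Suc (Suc (Suc (4 * i))))) mod 8 = 7" "(2 + 2 * int (Suc (Suc (Suc (4 * i))))) mod 8 = 0" for i
    by presburger+
  have 1: "e (Suc (4 * i)) = 1 \<and> o' (Suc (4 * i)) = 7" if "e (4 * i) = 1" "o' (4 * i) = 1" for i
    unfolding e o' that c by simp
  have 4: "e (4 * i) = 1 \<and> o' (4 * i) = 1" for i
  proof (induction i)
    case 0
    then show ?case by (simp add: e_def o'_def residue_1)
  next
    case (Suc i)
    have 2: "e (Suc (Suc (4 * i))) = 3 \<and> o' (Suc (Suc (4 * i))) = 7"
      unfolding e[of "Suc (4 * i)"] o'[of "Suc (4 * i)"] c using 1[of i] Suc by simp
    have 3: "e (Suc (Suc (Suc (4 * i)))) = 7 \<and> o' (Suc (Suc (Suc (4 * i)))) = 5"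
      unfolding e[of "Suc (Suc (4 * i))"] o'[of "Suc (Suc (4 * i))"] c using 2 by simp
    have "e (Suc (Suc (Suc (Suc (4 * i))))) = 1 \<and> o' (Suc (Suc (Suc (Suc (4 * i))))) = 1"
      unfolding e[of "Suc (Suc (Suc (4 * i)))"] o'[of "Suc (Suc (Suc (4 * i)))"] c using 3 by simp
    moreover have "4 * Suc i = Suc (Suc (Suc (Suc (4 * i))))" by simp
    ultimately show ?case by (simp only: simp_thms)
  qed
  show ?thesis using 4 1 unfolding e_def o'_def by blast
qed

text \<open>
  With \<open>x = 0\<close> and \<open>q = 1\<close> modulo 4 the recursion reads \<open>e (j + 1) = - (2 * j + 1) * e j\<close> modulo 4, which gives
  the cycle \<open>1, 3, 3, 1\<close>.
\<close>

lemma even_part_residue4: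
  assumes "residue x 2 = 0" "residue q 2 = 1"
  shows "residue (even_part x q (4 * i)) 2 = 1 \<and> residue (even_part x q (4 * i + 2)) 2 = 3"
proof -
  define e where "e j = residue (even_part x q j) 2" for j
  have "e (Suc j) = (- ((1 + 2 * int j) * e j)) mod 4" for j
    by (simp add: e_def assms residue_simps mod_simps)
  also have "\<dots> j = (- ((1 + 2 * int j) mod 4 * e j)) mod 4" for j
    by (intro mod_minus_cong mod_mult_cong refl mod_mod_trivial[symmetric])
  finally have e: "e (Suc j) = (- ((1 + 2 * int j) mod 4 * e j)) mod 4" for j .
  have c: "(1 + 2 * int (4 * i)) mod 4 = 1" "(1 + 2 * int (Suc (4 * i))) mod 4 = 3"
    "(1 + 2 * int (Suc (Suc (4 * i)))) mod 4 = 1" "(1 + 2 * int (Suc (Suc (Suc (4 * i))))) mod 4 = 3" for i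
    by presburger+
  have 2: "e (Suc (Suc (4 * i))) = 3" if "e (4 * i) = 1" for i
    unfolding e c that by simp
  have 4: "e (4 * i) = 1" for i
  proof (induction i)
    case 0
    then show ?case by (simp add: e_def residue_1)
  next
    case (Suc i)
    have "e (Suc (Suc (Suc (Suc (4 * i))))) = 1"
      unfolding e[of "Suc (Suc (Suc (4 * i)))"] e[of "Suc (Suc (4 * i))"] 2[OF Suc] c by simp
    moreover have "4 * Suc i = Suc (Suc (Suc (Suc (4 * i))))" by simp
    ultimately show ?case by (simp only: simp_thms)
  qed
  show ?thesis using 4 2 unfolding e_def by simp
qed

section \<open>The square class of the constant factor\<close>

text \<open>
  Even exponents contribute squares and an odd \<open>k\<close> contributes \<open>2 * k\<close> up to squares. The class has period 8
  in \<open>r\<close>, since among eight consecutive \<open>k\<close> there are four odd ones, whose product is 1 modulo 8.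
\<close>

lemma prod_powers_square_class:
  "\<exists>a b :: int. a \<noteq> 0 \<and> (\<Prod>k\<le>r. (2 * int k) ^ k) = a\<^sup>2 * (2 ^ (if r mod 8 \<in> {1, 2, 5, 6} then 1 else 0) * b) \<and>
     b mod 8 = (if r mod 8 \<in> {3, 4} then 3 else if r mod 8 \<in> {5, 6} then 7 else 1)"
  (is "\<exists>a b. ?P r a b")
proof (induction r)
  case 0
  show ?case by (intro exI[of _ 1]) simp
next
  case (Suc r)
  then obtain a b where ab: "?P r a b" by blast
  have s: "(\<Prod>k\<le>Suc r. (2 * int k) ^ k) = (\<Prod>k\<le>r. (2 * int k) ^ k) * (2 * int (Suc r)) ^ Suc r" by (rule prod.atMost_Suc)
  show ?case
  proof (cases "even (Suc r)")
    case True
    then obtain j where j: "Suc r = 2 * j" by (elim evenE)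
    have pow: "(2 * int (Suc r)) ^ Suc r = ((2 * int (Suc r)) ^ j)\<^sup>2"
      using arg_cong[OF j, of "\<lambda>m. (2 * int (Suc r)) ^ m"] unfolding mult.commute[of 2 j] power_mult .
    have "r mod 8 = 1 \<and> Suc r mod 8 = 2 \<or> r mod 8 = 3 \<and> Suc r mod 8 = 4
      \<or> r mod 8 = 5 \<and> Suc r mod 8 = 6 \<or> r mod 8 = 7 \<and> Suc r mod 8 = 0"
      using True by presburger
    then have "?P (Suc r) (a * (2 * int (Suc r)) ^ j) b"
      unfolding s pow using ab by (elim disjE conjE) (simp_all add: power_mult_distrib del: of_nat_Suc)
    then show ?thesis by blast
  next
    case False
    then have r: "even r" by simp
    then obtain j where j: "r = 2 * j" by (elim evenE)
    have pow: "(2 * int (Suc r)) ^ Suc r = ((2 * int (Suc r)) ^ j)\<^sup>2 * (2 * int (Suc r))"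
      using arg_cong[OF j, of "\<lambda>m. (2 * int (Suc r)) ^ m"] unfolding mult.commute[of 2 j] power_mult
      by (simp del: of_nat_Suc)
    have odd: "\<exists>a' b'. ?P (Suc r) a' b'" if "r mod 8 = d" "Suc r mod 8 = d'" "int (Suc r) mod 8 = t" "d = 0 \<and> d' = 1 \<and> t = 1 \<or> d = 4 \<and> d' = 5 \<and> t = 5 \<or> d = 2 \<and> d' = 3 \<and> t = 3 \<or> d = 6 \<and> d' = 7 \<and> t = 7" for d d' t
    proof -
      have "(b * int (Suc r)) mod 8 = ((b mod 8) * t) mod 8"
        unfolding that(3)[symmetric] by (simp only: mod_mult_eq)
      then have "?P (Suc r) ((if d = 2 \<or> d = 6 then 2 else 1) * (a * (2 * int (Suc r)) ^ j)) (b * int (Suc r))"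
        unfolding s pow using ab that by (elim disjE conjE) (simp_all add: power_mult_distrib del: of_nat_Suc)
      then show ?thesis by blast
    qed
    have "int (Suc r) mod 8 = int (Suc r mod 8)" by (simp only: zmod_int of_nat_numeral)
    moreover have "r mod 8 = 0 \<and> Suc r mod 8 = 1 \<or> r mod 8 = 2 \<and> Suc r mod 8 = 3
      \<or> r mod 8 = 4 \<and> Suc r mod 8 = 5 \<or> r mod 8 = 6 \<and> Suc r mod 8 = 7"
      using r by presburger
    ultimately show ?thesis
      by (elim disjE conjE) (rule odd, assumption, assumption, simp, simp)+
  qed
qed

text \<open>
  The exponent \<open>(r + 1) * (r - 1)\<close> of the remaining power of two is odd exactly for even \<open>r\<close>, so a factor 2
  is exchanged for those \<open>r\<close>.
\<close>

lemma disc_const_class: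
  assumes "r > 0"
  shows "\<exists>b. b mod 8 = (if r mod 8 \<in> {3, 4} then 3 else if r mod 8 \<in> {5, 6} then 7 else 1) \<and>
    sqclass (of_int (disc_const r)) (of_int (2 ^ (if r mod 8 \<in> {0, 1, 4, 5} then 1 else 0) * b))"
proof -
  define e where "e = (if r mod 8 \<in> {1, 2, 5, 6} then 1 else 0 :: nat)"
  obtain a b where a: "a \<noteq> 0" and prod: "(\<Prod>k\<le>r. (2 * int k) ^ k) = a\<^sup>2 * (2 ^ e * b)"
    and b: "b mod 8 = (if r mod 8 \<in> {3, 4} then 3 else if r mod 8 \<in> {5, 6} then 7 else 1)"
    using prod_powers_square_class[of r] unfolding e_def by blast
  have dc: "disc_const r = 2 ^ ((r + 1) * (r - 1)) * (a\<^sup>2 * (2 ^ e * b))"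
    by (simp only: disc_const_def prod)
  obtain c where "c \<noteq> 0" "disc_const r = c\<^sup>2 * (2 ^ (if r mod 8 \<in> {0, 1, 4, 5} then 1 else 0) * b)"
  proof (cases "even r")
    case True
    then obtain j where j: "r = 2 * j" by (elim evenE)
    then obtain i where i: "j = Suc i" using assms by (cases j) auto
    have "(r + 1) * (r - 1) = (2 * i * i + 4 * i + 1) * 2 + 1"
      unfolding j i by (simp add: algebra_simps)
    then have p: "(2 :: int) ^ ((r + 1) * (r - 1)) = (2 ^ (2 * i * i + 4 * i + 1))\<^sup>2 * 2"
      by (simp only: power_add power_mult power_one_right)
    have "r mod 8 = 0 \<or> r mod 8 = 2 \<or> r mod 8 = 4 \<or> r mod 8 = 6" using True by presburger
    then have "disc_const r = (2 ^ (2 * i * i + 4 * i + 1) * a * 2 ^ e)\<^sup>2 * (2 ^ (if r mod 8 \<in> {0, 1, 4, 5} then 1 else 0) * b)"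
      unfolding dc p e_def by (elim disjE) (simp_all add: power_mult_distrib)
    then show ?thesis using that a by (metis mult_eq_0_iff power_not_zero zero_neq_numeral)
  next
    case False
    then obtain j where j: "r = 2 * j + 1" by (elim oddE)
    have "(r + 1) * (r - 1) = (2 * j * (j + 1)) * 2"
      unfolding j by (simp add: algebra_simps)
    then have p: "(2 :: int) ^ ((r + 1) * (r - 1)) = (2 ^ (2 * j * (j + 1)))\<^sup>2"
      by (simp only: power_mult)
    have "r mod 8 = 1 \<or> r mod 8 = 3 \<or> r mod 8 = 5 \<or> r mod 8 = 7" using False by presburger
    then have "disc_const r = (2 ^ (2 * j * (j + 1)) * a)\<^sup>2 * (2 ^ (if r mod 8 \<in> {0, 1, 4, 5} then 1 else 0) * b)"
      unfolding dc p e_def by (elim disjE) (simp_all add: power_mult_distrib)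
    then show ?thesis using that a by (metis mult_eq_0_iff power_not_zero zero_neq_numeral)
  qed
  then have "sqclass (of_int (disc_const r)) (of_int (2 ^ (if r mod 8 \<in> {0, 1, 4, 5} then 1 else 0) * b))"
    using sqclass_of_int by metis
  then show ?thesis using b by blast
qed

section \<open>The square class of the variable factor\<close>

lemma to_fract_hermite_seq: "to_fract (hermite_seq p q k) = hermite_seq (to_fract p) (to_fract q) k"
  by (induction p q k rule: hermite_seq.induct) (simp_all add: to_fract_of_nat to_fract_numeral)

lemma to_fract_disc_form: "to_fract (disc_form r m p q) = disc_form r (to_fract m) (to_fract p) (to_fract q)"
  by (simp add: disc_form_def to_fract_hermite_seq to_fract_of_nat to_fract_numeral)

abbreviation disc_form_at :: "nat \<Rightarrow> 'a::comm_ring_1 \<Rightarrow> 'a" where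
  "disc_form_at r x \<equiv> disc_form r (2 * of_nat (Suc r)) (x\<^sup>2 + 2 * of_nat (Suc r)) (x\<^sup>2)"

lemma residue_of_nat_4: "residue (of_nat m) 2 = int (m mod 4)"
  and residue_of_nat_8: "residue (of_nat m) 3 = int (m mod 8)"
  by (simp_all add: residue_of_nat zmod_int)

lemma hermite_seq_residue_period:
  assumes "\<not> 2 dvd p"
  shows "k mod 4 = 0 \<Longrightarrow> residue (hermite_seq p q k) 2 = 1"
    and "k mod 4 = 2 \<Longrightarrow> residue (hermite_seq p q k) 2 = (1 + 2 * residue q 2) mod 4"
    and "k mod 4 = 3 \<Longrightarrow> residue (hermite_seq p q k) 2 = (residue p 2 + 2 * residue q 2) mod 4"
proof -
  define l where "l = k div 4"
  note h = hermite_seq_residue4[OF assms, of q]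
  have 0: "1 + 2 * residue q 2 * int (2 * l) = 1 + (residue q 2 * int l) * 4"
    by simp
  have 2: "x + 2 * residue q 2 * int (2 * l + 1) = x + 2 * residue q 2 + (residue q 2 * int l) * 4" for x
    by (simp add: algebra_simps)
  show "residue (hermite_seq p q k) 2 = 1" if "k mod 4 = 0"
  proof -
    have "k = 2 * (2 * l)" using that unfolding l_def by presburger
    then have "residue (hermite_seq p q k) 2 = (1 + 2 * residue q 2 * int (2 * l)) mod 4"
      using h[of "2 * l"] by (simp only:)
    then show ?thesis unfolding 0 mod_mult_self1 by simp
  qed
  show "residue (hermite_seq p q k) 2 = (1 + 2 * residue q 2) mod 4" if "k mod 4 = 2"
  proof -
    have "k = 2 * (2 * l + 1)" using that unfolding l_def by presburger
    then have "residue (hermite_seq p q k) 2 = (1 + 2 * residue q 2 * int (2 * l + 1)) mod 4"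
      using h[of "2 * l + 1"] by (simp only:)
    then show ?thesis unfolding 2 mod_mult_self1 .
  qed
  show "residue (hermite_seq p q k) 2 = (residue p 2 + 2 * residue q 2) mod 4" if "k mod 4 = 3"
  proof -
    have "k = Suc (2 * (2 * l + 1))" using that unfolding l_def by presburger
    then have "residue (hermite_seq p q k) 2 = (residue p 2 + 2 * residue q 2 * int (2 * l + 1)) mod 4"
      using h[of "2 * l + 1"] by (simp only:)
    then show ?thesis unfolding 2 mod_mult_self1 .
  qed
qed

text \<open>
  For \<open>r\<close> congruent to 4 only the first term survives modulo 4, and \<open>h r\<close> is 1 there. For \<open>r\<close>
  congruent to 5 the coefficients are 2 and 1, the term \<open>h r\<close> is odd and \<open>h (r - 1)\<close> is 1, so that the
  difference is \<open>2 - 1\<close>.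
\<close>

lemma disc_form_cofactor_residue:
  fixes p q :: two_adic_int
  assumes "\<not> 2 dvd p" "r mod 8 \<in> {4, 5}"
  shows "residue (of_nat (Suc r) * hermite_seq p q r - of_nat r * hermite_seq p q (r - 1)) 2 = 1"
proof -
  consider "r mod 8 = 4" | "r mod 8 = 5" using assms(2) by blast
  then show ?thesis
  proof cases
    case 1
    then have "r mod 4 = 0" "Suc r mod 4 = 1" by presburger+
    then show ?thesis
      using hermite_seq_residue_period(1)[OF assms(1), of r q]
      by (simp add: residue_minus residue_times residue_of_nat_4 del: of_nat_Suc)
  next
    case 2
    then have r: "r mod 4 = 1" "Suc r mod 4 = 2" "(r - 1) mod 4 = 0" by presburger+
    have "residue (hermite_seq p q r) 2 = 1 \<or> residue (hermite_seq p q r) 2 = 3"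
      using odd_residue2_cases hermite_seq_odd[OF assms(1)] by blast
    then show ?thesis
      using hermite_seq_residue_period(1)[OF assms(1) r(3), of q] r
      by (auto simp: residue_minus residue_times residue_of_nat_4 simp del: of_nat_Suc)
  qed
qed

text \<open>
  Put \<open>w = 1 / x\<^sup>2 = a\<^sup>2\<close>. Scaling by \<open>x\<^sup>2\<close> leads to the integral parameters
  \<open>m = 2 * n * w\<close>, \<open>p = 1 + 2 * n * w\<close>, \<open>q = w\<close> with \<open>p\<close> odd, and the form is \<open>2 * w\<close> times
  \<open>n * h r - r * h (r - 1)\<close>, where \<open>2 * w\<close> is 2 up to squares.
\<close>

lemma disc_form_class_nonintegral:
  assumes "a \<noteq> 0" "x = inverse (to_fract a)" "r > 0"
  shows "\<exists>g. sqclass (disc_form_at r x) (2 * g) \<and> \<not> 2 dvd g \<and> (r mod 8 \<in> {4, 5} \<longrightarrow> residue g 2 = 1)"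
proof -
  define N :: two_adic_int where "N = of_nat (Suc r)"
  define p where "p = 1 + 2 * N * a\<^sup>2"
  define g where "g = of_nat (Suc r) * hermite_seq p (a\<^sup>2) r - of_nat r * hermite_seq p (a\<^sup>2) (r - 1)"
  have a0: "to_fract a \<noteq> 0" using assms(1) by simp
  have x0: "x \<noteq> 0" using a0 assms(2) by simp
  have xa: "x\<^sup>2 * (to_fract a)\<^sup>2 = 1" using a0 unfolding assms(2) by (simp add: power_inverse)
  have "disc_form r (2 * N * a\<^sup>2) p (a\<^sup>2) = 2 * g * a\<^sup>2"
    unfolding disc_form_def g_def N_def by (simp add: algebra_simps del: of_nat_Suc)
  then have "disc_form r (to_fract (2 * N * a\<^sup>2)) (to_fract p) (to_fract (a\<^sup>2)) = to_fract (2 * g) * (to_fract a)\<^sup>2"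
    by (metis to_fract_disc_form to_fract_mult to_fract_power)
  then have "(x\<^sup>2) ^ Suc r * (to_fract (2 * g) * (to_fract a)\<^sup>2) =
    disc_form r (x\<^sup>2 * to_fract (2 * N * a\<^sup>2)) (x\<^sup>2 * to_fract p) ((x\<^sup>2)\<^sup>2 * to_fract (a\<^sup>2))"
    using disc_form_scale[OF assms(3), of "x\<^sup>2"] by metis
  also have "x\<^sup>2 * to_fract (2 * N * a\<^sup>2) = 2 * of_nat (Suc r) * (x\<^sup>2 * (to_fract a)\<^sup>2)"
    unfolding N_def by (simp only: to_fract_mult to_fract_numeral to_fract_of_nat to_fract_power mult_ac)
  also have "x\<^sup>2 * to_fract p = x\<^sup>2 + 2 * of_nat (Suc r) * (x\<^sup>2 * (to_fract a)\<^sup>2)"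
    unfolding p_def N_def by (simp only: to_fract_mult to_fract_add to_fract_1 to_fract_numeral to_fract_of_nat to_fract_power mult_ac distrib_left mult_1)
  also have "(x\<^sup>2)\<^sup>2 * to_fract (a\<^sup>2) = x\<^sup>2 * (x\<^sup>2 * (to_fract a)\<^sup>2)"
    by (simp only: to_fract_power power2_eq_square to_fract_mult mult_ac)
  finally have "disc_form_at r x = (x\<^sup>2) ^ Suc r * (to_fract (2 * g) * (to_fract a)\<^sup>2)"
    unfolding xa by (simp only: mult_1_right)
  also have "\<dots> = to_fract (2 * g) * (x ^ Suc r * to_fract a)\<^sup>2"
    by (simp only: power_mult_distrib power_mult[symmetric] mult.commute[of 2] mult_ac)
  finally have "sqclass (disc_form_at r x) (2 * g)"
    unfolding sqclass_def using a0 x0 by (intro exI[of _ "x ^ Suc r * to_fract a"]) simp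
  moreover have p: "\<not> 2 dvd p"
    unfolding odd_two_adic p_def by simp
  moreover have "\<not> 2 dvd g"
  proof -
    obtain u v where "hermite_seq p (a\<^sup>2) r = 1 + 2 * u" "hermite_seq p (a\<^sup>2) (r - 1) = 1 + 2 * v"
      using hermite_seq_odd[OF p] odd_obtain by metis
    then have "g - 1 = 2 * (u + of_nat r * (u - v))"
      unfolding g_def by (simp add: algebra_simps)
    then show ?thesis unfolding odd_two_adic by simp
  qed
  moreover have "residue g 2 = 1" if "r mod 8 \<in> {4, 5}"
    unfolding g_def by (rule disc_form_cofactor_residue[OF p that])
  ultimately show ?thesis by blast
qed

text \<open>
  The first factor 2 comes out by scaling; what is left has \<open>m = n\<close> and \<open>p = 2 * a\<^sup>2 + n\<close>, whose
  parity is that of \<open>n = r + 1\<close>.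
\<close>

lemma disc_form_class_integral:
  assumes "r > 0"
  shows "disc_form_at r (to_fract (2 * a)) = to_fract (2 ^ Suc r * disc_form r (of_nat (Suc r)) (2 * a\<^sup>2 + of_nat (Suc r)) (a\<^sup>2))"
proof -
  have "disc_form_at r (2 * a) = disc_form r (2 * of_nat (Suc r)) (2 * (2 * a\<^sup>2 + of_nat (Suc r))) (2\<^sup>2 * a\<^sup>2)"
    by (simp add: power_mult_distrib distrib_left del: of_nat_Suc)
  also have "\<dots> = 2 ^ Suc r * disc_form r (of_nat (Suc r)) (2 * a\<^sup>2 + of_nat (Suc r)) (a\<^sup>2)"
    by (rule disc_form_scale[OF assms])
  finally show ?thesis
    by (simp only: to_fract_disc_form[symmetric] to_fract_power[symmetric] to_fract_numeral[symmetric] to_fract_of_nat[symmetric] to_fract_mult[symmetric] to_fract_add[symmetric])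
qed

lemma sqclass_even_power:
  assumes "even k" "sqclass q (2 ^ k * u)"
  shows "sqclass q u"
proof -
  obtain l where "k = 2 * l" using assms(1) by (elim evenE)
  then have "(2 :: two_adic_int) ^ k = (2 ^ l)\<^sup>2" by (simp add: power_mult power2_eq_square flip: power_mult_distrib)
  then show ?thesis using assms(2) sqclass_strip[of "2 ^ l" q u] by simp
qed

lemma sqclass_odd_power: "odd k \<Longrightarrow> sqclass q (2 ^ k * u) \<Longrightarrow> sqclass q (2 * u)"
  using sqclass_even_power[of "k - 1" q "2 * u"] by (cases k) (simp_all add: mult_ac)

lemma odd_of_nat: "odd m \<Longrightarrow> \<not> 2 dvd (of_nat m :: two_adic_int)"
  by (simp add: odd_iff_residue[of 1] residue_of_nat)

lemma two_dvd_add_even: "\<not> 2 dvd y \<Longrightarrow> \<not> 2 dvd 2 * x + (y :: two_adic_int)"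
  by (metis dvd_add_right_iff dvd_triv_left)

text \<open>
  For even \<open>r\<close> the scaling power \<open>2 ^ (r + 1)\<close> has odd exponent and both \<open>m\<close> and \<open>p\<close> are odd.
\<close>

lemma disc_form_class_even_index:
  assumes "r > 0" "even r"
  shows "\<exists>g. sqclass (disc_form_at r (to_fract (2 * a))) (2 * g) \<and> \<not> 2 dvd g \<and> (r mod 8 = 4 \<longrightarrow> residue g 2 = 1)"
proof -
  define p where "p = 2 * a\<^sup>2 + of_nat (Suc r)"
  define g where "g = disc_form r (of_nat (Suc r)) p (a\<^sup>2)"
  have "sqclass (disc_form_at r (to_fract (2 * a))) (2 ^ Suc r * g)"
    unfolding disc_form_class_integral[OF assms(1)] g_def p_def by (rule sqclass_to_fract)
  then have "sqclass (disc_form_at r (to_fract (2 * a))) (2 * g)"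
    by (rule sqclass_odd_power[rotated]) (simp add: assms)
  moreover have n: "\<not> 2 dvd (of_nat (Suc r) :: two_adic_int)" using assms by (intro odd_of_nat) simp
  moreover have p: "\<not> 2 dvd p" unfolding p_def by (rule two_dvd_add_even[OF n])
  moreover have "\<not> 2 dvd g" unfolding g_def by (rule disc_form_odd[OF n p])
  moreover have "residue g 2 = 1" if "r mod 8 = 4"
  proof -
    have "r mod 4 = 0" "Suc r mod 4 = 1" using that by presburger+
    then show ?thesis
      using hermite_seq_residue_period(1)[OF p, of r "a\<^sup>2"]
      by (simp add: g_def disc_form_def residue_minus residue_times residue_of_nat_4 del: of_nat_Suc)
  qed
  ultimately show ?thesis by blast
qed


lemma disc_form_class_odd_index:
  assumes "odd r"
  shows "sqclass (disc_form_at r (to_fract (2 * a))) (disc_form r (of_nat (Suc r)) (2 * a\<^sup>2 + of_nat (Suc r)) (a\<^sup>2))"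
proof -
  have "r > 0" using assms by (cases r) auto
  then show ?thesis
    using sqclass_to_fract[of "2 ^ Suc r * disc_form r (of_nat (Suc r)) (2 * a\<^sup>2 + of_nat (Suc r)) (a\<^sup>2)"] assms
    unfolding disc_form_class_integral[OF \<open>r > 0\<close>] by (rule_tac sqclass_even_power[of "Suc r"]) simp_all
qed

text \<open>
  For odd \<open>r\<close> the scaling power \<open>2 ^ (r + 1)\<close> is a square and does not affect the class.
\<close>

lemma disc_form_class_halve:
  assumes "odd r" "sqclass q (disc_form r (2 * m) (2 * (4 * b + m)) (4 * b))"
  shows "sqclass q (disc_form r m (4 * b + m) b)"
proof -
  have "r > 0" using assms by (cases r) auto
  then have "disc_form r (2 * m) (2 * (4 * b + m)) (4 * b) = 2 ^ Suc r * disc_form r m (4 * b + m) b"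
    using disc_form_scale[of r 2 m "4 * b + m" b] by simp
  then show ?thesis using assms by (rule_tac sqclass_even_power[of "Suc r"]) simp_all
qed

text \<open>
  Here \<open>n = 2 * M\<close> with \<open>M\<close> congruent to 3 modulo 4. If \<open>a\<close> is even, a second scaling by 2 makes
  \<open>m\<close> and \<open>p\<close> odd. If \<open>a\<close> is odd, then \<open>t = a\<^sup>2 + M\<close> is divisible by 4, and the form is \<open>2 ^ (k + 1)\<close>
  with \<open>k + 1\<close> odd times a number that is \<open>- even_part (t\<^sup>2) (a\<^sup>2) k = - 3\<close> modulo 4.
\<close>

lemma disc_form_class_mod8_eq_5:
  assumes "r mod 8 = 5"
  shows "\<exists>g. sqclass (disc_form_at r (to_fract (2 * a))) g \<and> \<not> 2 dvd g \<or>
    sqclass (disc_form_at r (to_fract (2 * a))) (2 * g) \<and> residue g 2 = 1"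
proof -
  define i where "i = r div 8"
  have r: "r = Suc (2 * (4 * i + 2))" using assms unfolding i_def by presburger
  define M :: two_adic_int where "M = of_nat (4 * i + 3)"
  have N: "(of_nat (Suc r) :: two_adic_int) = 2 * M"
    unfolding M_def r by simp
  have M: "\<not> 2 dvd M" unfolding M_def by (intro odd_of_nat) simp
  have M4: "residue M 2 = 3" unfolding M_def residue_of_nat_4 by simp
  have G: "sqclass (disc_form_at r (to_fract (2 * a))) (disc_form r (2 * M) (2 * (a\<^sup>2 + M)) (a\<^sup>2))"
    using disc_form_class_odd_index[of r a] r unfolding N distrib_left by simp
  show ?thesis
  proof (cases "2 dvd a")
    case True
    then obtain b where b: "a = 2 * b" by (elim dvdE)
    have "sqclass (disc_form_at r (to_fract (2 * a))) (disc_form r M (4 * b\<^sup>2 + M) (b\<^sup>2))"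
      using G r by (rule_tac disc_form_class_halve) (simp_all add: b power_mult_distrib)
    moreover have "\<not> 2 dvd disc_form r M (4 * b\<^sup>2 + M) (b\<^sup>2)"
      using two_dvd_add_even[OF M, of "2 * b\<^sup>2"] by (intro disc_form_odd M) simp
    ultimately show ?thesis by blast
  next
    case False
    define k where "k = 4 * i + 2"
    define t where "t = a\<^sup>2 + M"
    define g where "g = 2 * M * t * odd_part (t\<^sup>2) (a\<^sup>2) k - of_nat (2 * k + 1) * a\<^sup>2 * even_part (t\<^sup>2) (a\<^sup>2) k"
    have a2: "residue (a\<^sup>2) 2 = 1" using odd_square_residue[OF False] by blast
    have t: "residue t 2 = 0" unfolding t_def by (simp add: residue_plus a2 M4)
    have t2: "residue (t\<^sup>2) 2 = 0" by (simp add: power2_eq_square residue_times t)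
    have "disc_form r (2 * M) (2 * t) (a\<^sup>2) = 2 ^ Suc k * g"
      unfolding r k_def[symmetric] g_def by (rule disc_form_double)
    then have "sqclass (disc_form_at r (to_fract (2 * a))) (2 ^ Suc k * g)"
      using G unfolding t_def by simp
    then have "sqclass (disc_form_at r (to_fract (2 * a))) (2 * g)"
      by (rule sqclass_odd_power[rotated]) (simp add: k_def)
    moreover have "residue g 2 = 1"
    proof -
      have "residue (even_part (t\<^sup>2) (a\<^sup>2) k) 2 = 3"
        unfolding k_def using even_part_residue4[OF t2 a2] by blast
      moreover have "residue (of_nat (2 * k + 1) :: two_adic_int) 2 = 1"
        unfolding residue_of_nat_4 k_def by (simp, presburger)
      ultimately show ?thesis
        unfolding g_def by (simp add: residue_minus residue_times a2 t del: of_nat_add of_nat_mult of_nat_Suc)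
    qed
    ultimately show ?thesis by blast
  qed
qed

text \<open>
  Here \<open>n\<close> is 4 times an odd number, which is called \<open>n\<close> in the proof. If \<open>a\<close> is odd, \<open>t\<close> is odd
  and the cofactor of the even power of two is \<open>- 3 * even_part (t\<^sup>2) (a\<^sup>2) k = - 3\<close> modulo 4. If
  \<open>a = 2 * b\<close> with \<open>b\<close> odd, one scaling by 2 leads again to an odd \<open>t\<close>, but now the term with
  \<open>odd_part\<close> matters, and the cofactor is \<open>6 * 7 - 3 = 7\<close> modulo 8. If \<open>b\<close> is even, a further scaling
  makes \<open>p\<close> odd.
\<close>

lemma disc_form_class_mod8_eq_3:
  assumes "r mod 8 = 3"
  shows "\<exists>g. sqclass (disc_form_at r (to_fract (2 * a))) g \<and> (residue g 2 = 1 \<or> residue g 3 = 7)"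
proof -
  define i where "i = r div 8"
  have r: "r = Suc (2 * Suc (4 * i))" using assms unfolding i_def by presburger
  define k where "k = Suc (4 * i)"
  have rk: "r = Suc (2 * k)" by (simp add: r k_def)
  define n :: two_adic_int where "n = of_nat (2 * i + 1)"
  have N: "(of_nat (Suc r) :: two_adic_int) = 4 * n"
    unfolding n_def r by simp
  have n: "\<not> 2 dvd n" unfolding n_def by (intro odd_of_nat) simp
  have n2: "residue (n * n) 3 = 1" using odd_square_residue[OF n] by (simp add: power2_eq_square)
  have "(2 * k + 1) mod 4 = 3" "(2 * k + 1) mod 8 = 3" unfolding k_def by presburger+
  then have k4: "residue (of_nat (2 * k + 1) :: two_adic_int) 2 = 3"
    and k8: "residue (of_nat (2 * k + 1) :: two_adic_int) 3 = 3"
    by (simp_all only: residue_of_nat_4 residue_of_nat_8 of_nat_numeral)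
  have odd_r: "odd r" and even_k: "even (Suc k)" by (simp_all add: r k_def)
  have G: "sqclass (disc_form_at r (to_fract (2 * a))) (disc_form r (4 * n) (2 * (a\<^sup>2 + 2 * n)) (a\<^sup>2))"
    using disc_form_class_odd_index[OF odd_r, of a] unfolding N distrib_left by simp
  show ?thesis
  proof (cases "2 dvd a")
    case False
    define t where "t = a\<^sup>2 + 2 * n"
    define g where "g = 4 * n * t * odd_part (t\<^sup>2) (a\<^sup>2) k - of_nat (2 * k + 1) * a\<^sup>2 * even_part (t\<^sup>2) (a\<^sup>2) k"
    have a2: "residue (a\<^sup>2) 2 = 1" "residue (a\<^sup>2) 3 = 1" using odd_square_residue[OF False] by blast+
    have "\<not> 2 dvd t" unfolding t_def using two_dvd_add_even[of "a\<^sup>2" n] False by (simp add: add.commute power2_eq_square two_dvd_mult)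
    then have t2: "residue (t\<^sup>2) 3 = 1" using odd_square_residue by blast
    have "disc_form r (4 * n) (2 * t) (a\<^sup>2) = 2 ^ Suc k * g"
      unfolding rk g_def by (rule disc_form_double)
    then have "sqclass (disc_form_at r (to_fract (2 * a))) (2 ^ Suc k * g)"
      using G unfolding t_def by simp
    then have "sqclass (disc_form_at r (to_fract (2 * a))) g"
      by (rule sqclass_even_power[OF even_k])
    moreover have "residue g 2 = 1"
    proof -
      have "residue (even_part (t\<^sup>2) (a\<^sup>2) k) 3 = 1"
        unfolding k_def using even_odd_part_residue8[OF t2 a2(2)] by blast
      then have "residue (even_part (t\<^sup>2) (a\<^sup>2) k) 2 = 1"
        using residue_mod[of 2 3 "even_part (t\<^sup>2) (a\<^sup>2) k"] by simp
      then show ?thesis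
        unfolding g_def using k4 by (simp add: residue_minus residue_times residue_numeral a2 del: of_nat_add of_nat_mult of_nat_Suc)
    qed
    ultimately show ?thesis by blast
  next
    case True
    then obtain b where b: "a = 2 * b" by (elim dvdE)
    have G2: "sqclass (disc_form_at r (to_fract (2 * a))) (disc_form r (2 * n) (4 * b\<^sup>2 + 2 * n) (b\<^sup>2))"
      using G by (rule_tac disc_form_class_halve[OF odd_r]) (simp_all add: b power_mult_distrib)
    show ?thesis
    proof (cases "2 dvd b")
      case True
      then obtain c where c: "b = 2 * c" by (elim dvdE)
      define g where "g = disc_form r n (8 * c\<^sup>2 + n) (c\<^sup>2)"
      have p: "\<not> 2 dvd 8 * c\<^sup>2 + n" using two_dvd_add_even[OF n, of "4 * c\<^sup>2"] by simp
      have "disc_form r (2 * n) (4 * b\<^sup>2 + 2 * n) (b\<^sup>2) = 2 ^ Suc r * g"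
        using disc_form_scale[of r 2 n "8 * c\<^sup>2 + n" "c\<^sup>2"] r by (simp add: c g_def power_mult_distrib)
      then have "sqclass (disc_form_at r (to_fract (2 * a))) g"
        using G2 odd_r by (rule_tac sqclass_even_power[of "Suc r"]) simp_all
      moreover have "residue g 2 = 1"
      proof -
        have rm: "r mod 4 = 3" using assms by presburger
        have "r - 1 = 2 * Suc (4 * i)" using r by simp
        then have rm': "(r - 1) mod 4 = 2" by presburger
        have p2: "residue (8 * c\<^sup>2 + n) 2 = residue n 2"
          using residue_mod[of 2 2 n] by (simp add: residue_plus residue_times residue_numeral)
        have "odd (residue n 2)" using n by (simp add: odd_iff_residue[of 2])
        then obtain x where x: "residue n 2 = 2 * x + 1" by (elim oddE)
        define y where "y = residue (c\<^sup>2) 2"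
        have h: "residue (hermite_seq (8 * c\<^sup>2 + n) (c\<^sup>2) r) 2 = (2 * x + 1 + 2 * y) mod 4"
            "residue (hermite_seq (8 * c\<^sup>2 + n) (c\<^sup>2) (r - 1)) 2 = (1 + 2 * y) mod 4"
          using hermite_seq_residue_period(3)[OF p rm] hermite_seq_residue_period(2)[OF p rm'] unfolding p2 x y_def by blast+
        have "residue (2 * of_nat r * c\<^sup>2) 2 = (2 * y) mod 4"
          using rm by (simp add: residue_times residue_of_nat_4 residue_numeral y_def mod_simps)
        then have "residue g 2 = (((2 * x + 1) * ((2 * x + 1 + 2 * y) mod 4)) mod 4 - (((2 * y) mod 4) * ((1 + 2 * y) mod 4)) mod 4) mod 4"
          unfolding g_def disc_form_def by (simp only: residue_minus residue_times[of n] residue_times[of "2 * of_nat r * c\<^sup>2"] h x) simp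
        also have "\<dots> = ((2 * x + 1) * (2 * x + 1 + 2 * y) - (2 * y) * (1 + 2 * y)) mod 4"
          by (simp only: mod_simps)
        also have "\<dots> = 1 mod 4"
          \<comment> \<open>a quarter of the difference\<close>
          unfolding mod_eq_dvd_iff by (rule dvdI[of _ _ "x * x + x + x * y - y * y"]) (simp add: algebra_simps)
        finally show ?thesis by simp
      qed
      ultimately show ?thesis by blast
    next
      case False
      define t where "t = 2 * b\<^sup>2 + n"
      define g where "g = 2 * n * t * odd_part (t\<^sup>2) (b\<^sup>2) k - of_nat (2 * k + 1) * b\<^sup>2 * even_part (t\<^sup>2) (b\<^sup>2) k"
      have b2: "residue (b\<^sup>2) 3 = 1" using odd_square_residue[OF False] by blast
      have "\<not> 2 dvd t" unfolding t_def by (rule two_dvd_add_even[OF n])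
      then have t2: "residue (t\<^sup>2) 3 = 1" using odd_square_residue by blast
      have "disc_form r (2 * n) (2 * t) (b\<^sup>2) = 2 ^ Suc k * g"
        unfolding rk g_def by (rule disc_form_double)
      then have "sqclass (disc_form_at r (to_fract (2 * a))) (2 ^ Suc k * g)"
        using G2 unfolding t_def by (simp add: distrib_left)
      then have "sqclass (disc_form_at r (to_fract (2 * a))) g"
        by (rule sqclass_even_power[OF even_k])
      moreover have "residue g 3 = 7"
      proof -
        have e: "residue (even_part (t\<^sup>2) (b\<^sup>2) k) 3 = 1" "residue (odd_part (t\<^sup>2) (b\<^sup>2) k) 3 = 7"
          unfolding k_def using even_odd_part_residue8[OF t2 b2] by blast+
        have "2 * n * t = 4 * (n * b\<^sup>2) + 2 * (n * n)"
          unfolding t_def by (simp add: algebra_simps)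
        moreover have "residue (4 * (n * b\<^sup>2)) 3 = 4"
        proof -
          have "\<not> 2 dvd n * b\<^sup>2" using n False by (simp add: two_dvd_mult power2_eq_square)
          then obtain y where "n * b\<^sup>2 = 1 + 2 * y" using odd_obtain by blast
          then have "4 * (n * b\<^sup>2) = 4 + 8 * y" by simp
          then show ?thesis by (simp only: residue_plus residue_times residue_numeral) simp
        qed
        ultimately have "residue (2 * n * t) 3 = 6"
          by (simp add: residue_plus residue_times[of 2] residue_numeral n2)
        then show ?thesis
          unfolding g_def using k8 e b2
          by (simp add: residue_minus residue_times[of "2 * n * t"] residue_times[of "of_nat _ * _"] residue_times[of "of_nat _"]
              del: of_nat_add of_nat_mult of_nat_Suc)
      qed
      ultimately show ?thesis by blast
    qed
  qed
qed

section \<open>Solubility over the 2-adic numbers\<close>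

text \<open>
  Multiply the class of the constant by the class of the form. Either exactly one of them has odd valuation, or the
  valuation is even and the unit part is a residue among 3, 5 and 7 modulo 8.
\<close>

lemma values_nonsquare:
  assumes "r mod 8 \<in> {2, 3, 4, 5, 6}"
  shows "y\<^sup>2 \<noteq> of_int (disc_const r) * disc_form_at r (x :: two_adic)"
proof -
  have r0: "r > 0" using assms by (cases r) auto
  obtain b where b: "b mod 8 = (if r mod 8 \<in> {3, 4} then 3 else if r mod 8 \<in> {5, 6} then 7 else 1)"
    and D: "sqclass (of_int (disc_const r)) (of_int (2 ^ (if r mod 8 \<in> {0, 1, 4, 5} then 1 else 0) * b))"
    using disc_const_class[OF r0] by blast
  define \<beta> :: two_adic_int where "\<beta> = of_int b"
  have b3: "residue \<beta> 3 = b mod 8" unfolding \<beta>_def by (simp add: residue_of_int)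
  have b2: "residue \<beta> 2 = (b mod 8) mod 4" using residue_mod[of 2 3 \<beta>] b3 by simp
  have odd_b: "\<not> 2 dvd \<beta>" using b by (simp add: odd_iff_residue[of 3] b3)
  have odd_bg: "\<not> 2 dvd \<beta> * g" if "\<not> 2 dvd g" for g using odd_b that by (simp add: two_dvd_mult)
  let ?G = "disc_form_at r x"
  have concl: ?thesis if "sqclass ?G g" "sqclass (of_int (disc_const r)) d" "d * g = s\<^sup>2 * u" "s \<noteq> 0" "nonsquare_res u" for d g s u
    using sqclass_nonsquare[OF sqclass_strip[OF that(4), of _ u] that(5)] sqclass_mult[OF that(2,1)] that(3) by metis
  have D0: "sqclass (of_int (disc_const r)) \<beta>" if "r mod 8 \<in> {2, 3, 6}"
    using D that unfolding \<beta>_def by auto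
  have D1: "sqclass (of_int (disc_const r)) (2 * \<beta>)" if "r mod 8 \<in> {4, 5}"
    using D that unfolding \<beta>_def by auto
  have m3: "nonsquare_res (\<beta> * g)" if "residue g 2 = 1" "r mod 8 \<in> {3, 4, 5}" for g
    using that b by (intro nonsquare_resI_mod4) (auto simp: residue_times b2)
  have two: ?thesis if "sqclass ?G (2 * g)" "\<not> 2 dvd g" "r mod 8 \<in> {4, 5} \<longrightarrow> residue g 2 = 1" for g
  proof (cases "r mod 8 \<in> {4, 5}")
    case True
    have "nonsquare_res (\<beta> * g)" using m3 True that(3) by blast
    then show ?thesis by (intro concl[OF that(1) D1[OF True], of 2 "\<beta> * g"]) simp_all
  next
    case False
    then have "sqclass (of_int (disc_const r)) \<beta>" using D0 assms by blast
    then show ?thesis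
      by (intro concl[OF that(1), of \<beta> 1 "2 * (\<beta> * g)"] nonsquare_res_2_odd odd_bg that(2)) simp_all
  qed
  have four: "\<not> 2 dvd g" if "residue g 2 = 1" for g
    using that by (simp add: odd_iff_residue[of 2])
  show ?thesis
  proof (cases x rule: fract_integral_cases)
    case (2 a)
    then show ?thesis using disc_form_class_nonintegral[OF 2 r0] two by blast
  next
    case (1 a')
    then obtain a where "a' = 2 * a" by (elim dvdE)
    with 1 have x: "x = to_fract (2 * a)" by simp
    consider "r mod 8 \<in> {2, 4, 6}" | "r mod 8 = 3" | "r mod 8 = 5" using assms by blast
    then show ?thesis
    proof cases
      case 1
      then have "even r" "r mod 8 \<noteq> 5" using dvd_mod_iff[of 2 8 r] by auto
      then show ?thesis using disc_form_class_even_index[OF r0, of a] two unfolding x by blast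
    next
      case r3: 2
      obtain g where g: "sqclass ?G g" "residue g 2 = 1 \<or> residue g 3 = 7"
        using disc_form_class_mod8_eq_3[OF r3, of a] unfolding x by blast
      from g(2) have "nonsquare_res (\<beta> * g)"
      proof
        assume "residue g 2 = 1"
        then show ?thesis using m3 r3 by blast
      next
        assume "residue g 3 = 7"
        then show ?thesis using b r3 by (intro nonsquare_resI) (simp add: residue_times b3)
      qed
      then show ?thesis using D0 r3 by (intro concl[OF g(1), of \<beta> 1 "\<beta> * g"]) simp_all
    next
      case r5: 3
      obtain g where "sqclass ?G g \<and> \<not> 2 dvd g \<or> sqclass ?G (2 * g) \<and> residue g 2 = 1"
        using disc_form_class_mod8_eq_5[OF r5, of a] unfolding x by blast
      then show ?thesis
      proof
        assume g: "sqclass ?G g \<and> \<not> 2 dvd g"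
        then show ?thesis
          using D1 r5 by (intro concl[of g "2 * \<beta>" 1 "2 * (\<beta> * g)"] nonsquare_res_2_odd odd_bg) simp_all
      next
        assume "sqclass ?G (2 * g) \<and> residue g 2 = 1"
        then show ?thesis using two four by blast
      qed
    qed
  qed
qed

text \<open>
  Twice the constant has the classes \<open>1, 1, 2, 6, 3, 7, 14, 2\<close> for the remainders \<open>0, \<dots>, 7\<close> of \<open>r\<close>.
\<close>

lemma leading_coeff_square_class:
  assumes "r > 0"
  shows "(\<exists>y :: two_adic. y\<^sup>2 = of_int (2 * disc_const r)) \<longleftrightarrow> r mod 8 \<in> {0, 1}"
proof -
  obtain b where b: "b mod 8 = (if r mod 8 \<in> {3, 4} then 3 else if r mod 8 \<in> {5, 6} then 7 else 1)"
    and D: "sqclass (of_int (disc_const r)) (of_int (2 ^ (if r mod 8 \<in> {0, 1, 4, 5} then 1 else 0) * b))"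
    using disc_const_class[OF assms] by blast
  define \<beta> :: two_adic_int where "\<beta> = of_int b"
  have b3: "residue \<beta> 3 = b mod 8" unfolding \<beta>_def by (simp add: residue_of_int)
  have "sqclass (of_int (2 * disc_const r)) (2 * of_int (2 ^ (if r mod 8 \<in> {0, 1, 4, 5} then 1 else 0) * b))"
    using sqclass_mult[OF sqclass_to_fract[of 2] D] by (simp add: to_fract_numeral)
  moreover have "(2 :: two_adic_int) * of_int (2 ^ (if r mod 8 \<in> {0, 1, 4, 5} then 1 else 0) * b) =
      (if r mod 8 \<in> {0, 1, 4, 5} then 2\<^sup>2 * \<beta> else 2 * \<beta>)"
    by (simp add: \<beta>_def)
  ultimately have L: "sqclass (of_int (2 * disc_const r)) (if r mod 8 \<in> {0, 1, 4, 5} then 2\<^sup>2 * \<beta> else 2 * \<beta>)"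
    by (simp only:)
  show ?thesis
  proof (cases "r mod 8 \<in> {0, 1, 4, 5}")
    case True
    then have L': "sqclass (of_int (2 * disc_const r)) \<beta>"
      using L sqclass_strip[of 2] by simp
    show ?thesis
    proof (cases "r mod 8 \<in> {0, 1}")
      case T: True
      then have "residue \<beta> 3 = residue 1 3" using b b3 by (auto simp: residue_1)
      then obtain z where "\<beta> = z\<^sup>2" using square_if_cong_1[of \<beta>] residue_cong_dvd[of 3 \<beta> 1] by auto
      then show ?thesis using L' sqclass_square T by blast
    next
      case F: False
      then have "nonsquare_res \<beta>" using True b b3 by (intro nonsquare_resI) auto
      then show ?thesis using sqclass_nonsquare[OF L'] F by metis
    qed
  next
    case False
    have "\<not> 2 dvd \<beta>" using b by (simp add: odd_iff_residue[of 3] b3)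
    moreover have "sqclass (of_int (2 * disc_const r)) (2 * \<beta>)" using L False by (simp only: if_False)
    ultimately have no: "y\<^sup>2 \<noteq> of_int (2 * disc_const r)" for y :: two_adic
      using sqclass_nonsquare nonsquare_res_2_odd by metis
    show ?thesis using False by (simp only: no) simp
  qed
qed

text \<open>
  At \<open>c = 0\<close> the form is \<open>(2 * n) ^ n\<close> with \<open>n = r + 1\<close> even, and the constant is a square.
\<close>

lemma value_at_0_square:
  assumes "r mod 8 = 7"
  shows "\<exists>y :: two_adic. y\<^sup>2 = of_int (disc_const r) * disc_form_at r 0"
proof -
  have r0: "r > 0" using assms by (cases r) auto
  obtain b where b: "b mod 8 = 1" and D: "sqclass (of_int (disc_const r)) (of_int b)"
    using disc_const_class[OF r0] assms by auto
  have "8 dvd of_int b - (1 :: two_adic_int)"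
    using residue_cong_dvd[of 3 "of_int b" 1] b by (simp add: residue_of_int residue_1)
  then obtain z :: two_adic_int where "of_int b = z\<^sup>2" using square_if_cong_1 by blast
  then obtain y :: two_adic where y: "y\<^sup>2 = of_int (disc_const r)" using D sqclass_square by metis
  have h: "hermite_seq p 0 k = p ^ k" for p :: two_adic and k
    by (induction p "0 :: two_adic" k rule: hermite_seq.induct) simp_all
  have "odd r" using dvd_mod_iff[of 2 8 r] assms by auto
  then obtain j where "r = 2 * j + 1" by (elim oddE)
  then have j: "Suc r = Suc j * 2" by simp
  have "disc_form_at r (0 :: two_adic) = (2 * of_nat (Suc r)) ^ Suc r"
    by (simp add: disc_form_def h)
  also have "\<dots> = ((2 * of_nat (Suc r)) ^ Suc j)\<^sup>2"
    unfolding power_mult[symmetric] j ..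
  finally have "disc_form_at r (0 :: two_adic) = ((2 * of_nat (Suc r)) ^ Suc j)\<^sup>2" .
  then show ?thesis using y by (metis power_mult_distrib)
qed

theorem theorem5p8:
  fixes r :: nat
  assumes "r > 0"
  shows "(\<forall>c. poly (map_poly of_int (hermite_disc_poly r)) c = disc (hermite_shift r c)) \<and>
    degree (hermite_disc_poly r) = 2 * r \<and>
    (hyperelliptic_points r (map_poly of_int (hermite_disc_poly r) :: two_adic poly) = {}
       \<longleftrightarrow> r mod 8 \<in> {2, 3, 4, 5, 6})"
proof (intro conjI)
  note eq = hermite_disc_poly_eq[OF assms]
  show "\<forall>c. poly (map_poly of_int (hermite_disc_poly r)) c = disc (hermite_shift r c)"
    by (simp add: eq poly_disc_poly disc_hermite_shift[OF assms] del: of_nat_Suc)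
  show "degree (hermite_disc_poly r) = 2 * r"
    unfolding eq by (rule coeff_disc_poly[OF assms])
  define F :: "two_adic poly" where "F = map_poly of_int (disc_poly r)"
  have "degree F \<le> 2 * r"
    using coeff_disc_poly(1)[OF assms] by (intro degree_le) (simp add: F_def coeff_map_poly coeff_eq_0)
  then have "hyperelliptic_points r F \<noteq> {} \<longleftrightarrow> (\<exists>x y. y\<^sup>2 = poly F x) \<or> (\<exists>y. y\<^sup>2 = coeff F (2 * r))"
    by (rule hyperelliptic_points_nonempty_iff[OF assms])
  also have "\<dots> \<longleftrightarrow> (\<exists>x y :: two_adic. y\<^sup>2 = of_int (disc_const r) * disc_form_at r x) \<or>
      (\<exists>y :: two_adic. y\<^sup>2 = of_int (2 * disc_const r))"
    by (simp only: F_def poly_disc_poly coeff_map_poly[of of_int, OF of_int_0] coeff_disc_poly(2)[OF assms])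
  also have "\<dots> \<longleftrightarrow> r mod 8 \<notin> {2, 3, 4, 5, 6}"
  proof (cases "r mod 8 \<in> {2, 3, 4, 5, 6}")
    case True
    then show ?thesis
      using values_nonsquare[OF True] leading_coeff_square_class[OF assms] by auto
  next
    case False
    have "r mod 8 < 8" by simp
    with False have "r mod 8 = 7 \<or> r mod 8 \<in> {0, 1}" by auto
    then have "(\<exists>x y :: two_adic. y\<^sup>2 = of_int (disc_const r) * disc_form_at r x) \<or> (\<exists>y :: two_adic. y\<^sup>2 = of_int (2 * disc_const r))"
    proof
      assume "r mod 8 = 7"
      then obtain y :: two_adic where "y\<^sup>2 = of_int (disc_const r) * disc_form_at r 0"
        using value_at_0_square[of r] by auto
      then show ?thesis by (intro disjI1 exI)
    next
      assume "r mod 8 \<in> {0, 1}"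
      then show ?thesis using leading_coeff_square_class[OF assms] by (intro disjI2) (rule iffD2)
    qed
    then show ?thesis using False by simp
  qed
  finally show "hyperelliptic_points r (map_poly of_int (hermite_disc_poly r) :: two_adic poly) = {} \<longleftrightarrow>
      r mod 8 \<in> {2, 3, 4, 5, 6}"
    unfolding eq F_def[symmetric] by blast
qed

end
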